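(* Every general safe recursive function $f:\mathcal T(\mathcal C)^{k+l}\to\mathcal T(\mathcal C)$ can be computed by a constructor GRS $\mathcal G$ that is precedence terminating with argument separation and for which there is a constant $d\ge\max\big(\{\mathrm{ar}(g):g\in\mathcal F\}\cup\{|K{\restriction}r|:(K,l,r)\in\mathcal G_{\mathrm{fin}}\}\big)$ such that every rule $(K,l,r)\in\mathcal G_{\mathrm{inf}}$ satisfies: (i) $(K{\restriction}l)\cap\mathrm{nrm}$ is maximally shared; (ii) $K{\restriction}v$ is closed for every labeled $v\in\mathrm{nrm}(l)$; (iii) $\big|\{v\in\mathrm{nrm}(l):v\text{ unlabeled}\}\cup\bigcup_{v\in\mathrm{safe}(l)}V_{K\restriction v}\big|\le d$; (iv) $|K{\restriction}r|\le|K{\restriction}l|+\big|\bigcup_{v\in\mathrm{nrm}(r)}V_{K\restriction v}\big|$.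
   Context: General safe recursive functions. Fix a finite set $\mathcal C$ of constructors containing at least one constant, enumerated $c_1,\dots,c_{|\mathcal C|}$; $\mathcal T(\mathcal C)$ is the set of ground constructor terms. Functions carry a separation of arguments into normal and safe ones, written $f(x_1,\dots,x_k;y_1,\dots,y_l)$. The general safe recursive functions are the least class containing: constants $O^{k,l}_j(\vec x;\vec y)=c_j$ ($c_j$ a constant); constructors $C_j(;x_1,\dots,x_{\mathrm{ar}(c_j)})=c_j(x_1,\dots,x_{\mathrm{ar}(c_j)})$; projections $I^{k,l}_j(x_1,\dots,x_k;x_{k+1},\dots,x_{k+l})=x_j$; predecessors $P_{i,0}(;c_i)=c_i$ for constant $c_i$ and $P_{i,j}(;c_i(x_1,\dots,x_{\mathrm{ar}(c_i)}))=x_j$; conditional $C(;c_j(\vec x),y_1,\dots,y_{|\mathcal C|})=y_j$; and closed under safe composition $f(\vec x;\vec y)=h(x_{j_1},\dots,x_{j_m};g_1(\vec x;\vec y),\dots,g_n(\vec x;\vec y))$ with $\{j_1,\dots,j_m\}\subseteq\{1,\dots,k\}$, and general safe recursion $f(c_j(x_1,\dots,x_{\mathrm{ar}(c_j)}),\vec y;\vec z)=h_j(\vec x,\vec y;\vec z,f(x_1,\vec y;\vec z),\dots,f(x_{\mathrm{ar}(c_j)},\vec y;\vec z))$ for each constructor $c_j$ (for constants: $f(c_j,\vec y;\vec z)=h_j(\vec y;\vec z)$). Term graphs. $\mathcal F=\mathcal C\cup\mathcal D$ is a finite signature with arity $\mathrm{ar}$. A labeled graph: finite acyclic directed graph $(V_G,E_G)$,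 partial labeling $\mathrm{lab}_G:V_G\to\mathcal F$, successor function $\mathrm{att}_G:V_G\to V_G^*$ with $\mathrm{att}_G(v)$ of length $\mathrm{ar}(\mathrm{lab}_G(v))$ if $v$ is labeled and empty otherwise, its entries being exactly the $E_G$-successors of $v$. A term graph has a root $\rho_G$ from which all nodes are reachable; $\mathcal{TG}(\mathcal F)$, $\mathcal{TG}(\mathcal C)$ as usual. $G{\restriction}v$ is the sub-term graph rooted at $v$; $|G|=|V_G|$. Closed: all nodes labeled. Basic: $\mathrm{lab}_G(\rho_G)\in\mathcal D$ and $G{\restriction}v\in\mathcal{TG}(\mathcal C)$ for each successor $v$ of $\rho_G$. Each $G{\restriction}v$ has a term representation (unlabeled nodes as distinct variables); $G$ is maximally shared if distinct nodes have distinct term representations. Ground constructor terms are represented by closed term graphs over $\mathcal C$. Argument separation. Argument positions of each symbol are split into normal and safe; constructors have only safe positions; nodes with the same label have the same separation. $\mathrm{nrm}(v)$, $\mathrm{safe}(v)$ are the successors of $v$ at normal, resp. safe, positions. $H\sqsubset_{\mathrm{nrm}}G$ means $H=(G{\restriction}v){\restriction}u$ for some $v\in\mathrm{nrm}(\rho_G)$ and node $u$. For $G$ with $\mathrm{att}_G(\rho_G)=v_1,\dots,v_k;v_{k+1},\dots,v_{k+l}$, $G\cap\mathrm{nrm}$ is the term graph with root $\rho_G$ whose nodes are $\rho_G$, the nodes of $G{\restriction}v$ for $v\in\mathrm{nrm}(\rho_G)$, and $l$ fresh unlabeled nodes $u_1,\dots,u_l$, with $\mathrm{att}(\rho_G)=v_1,\dots,v_k;u_1,\dots,u_l$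 (if no safe successor of the root is labeled, $G\cap\mathrm{nrm}=G$). Rewriting. Homomorphisms preserve labels, successor sequences at labeled nodes and the normal/safe split. A graph rewrite rule $(K,l,r)$: labeled graph $K$, distinct nodes $l,r$, every unlabeled node of $K{\restriction}r$ in $K{\restriction}l$; constructor rule if $K{\restriction}l$ is basic. A GRS is a possibly infinite set of rules; a constructor GRS consists of constructor rules. The step $G\to_{\mathcal G}H$ via a rule $(K,l,r)$ and homomorphism $\varphi:K{\restriction}l\to G$ is the standard build/redirection/garbage-collection step replacing $G{\restriction}\varphi(l)$ by an instance of $K{\restriction}r$. $\mathcal D_{\mathrm{inf}}$: defined symbols labeling the left root of infinitely many rules; $\mathcal G_{\mathrm{inf}}$: rules whose left root label is in $\mathcal D_{\mathrm{inf}}$; $\mathcal G_{\mathrm{fin}}=\mathcal G\setminus\mathcal G_{\mathrm{inf}}$. A GRS computes $f$ if some defined symbol $\mathsf f$ with the same argument separation satisfies: for all inputs $\vec t$, every maximal rewrite sequence from the maximally shared closed basic term graph representing $\mathsf f(\vec t)$ is finite and ends in a closed term graph over $\mathcal C$ representing $f(\vec t)$. Precedence termination with argument separation. A precedence $\sqsubset$ is a well-founded strict partial order on $\mathcal F$ with constructors minimal. $H\sqsubset_{\mathrm{pt}}G$ holds if $\mathrm{lab}_H(v)\sqsubset\mathrm{lab}_G(\rho_G)$ for every labeled node $v$ of $H$ and either (1) $H=G{\restriction}u$ or $H\sqsubset_{\mathrm{pt}}G{\restriction}u$ for some successor $u$ of $\rho_G$; or (2) $\rho_H$ is labeled, $H{\restriction}v\sqsubset_{\mathrm{nrm}}G$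 for each $v\in\mathrm{nrm}(\rho_H)$, and $H{\restriction}v\sqsubset_{\mathrm{pt}}G$ for each $v\in\mathrm{safe}(\rho_H)$. A GRS is precedence terminating with argument separation if for some separation and precedence, $K{\restriction}r\sqsubset_{\mathrm{pt}}K{\restriction}l$ for every rule. *)

theory Defs
  imports Main
begin

datatype 'c gterm = T 'c "'c gterm list"

text \<open>The constructor set is given by an enumeration cs (c_1,...,c_|C|) and an arity function car.\<close>

fun gterm_ok :: "'c list \<Rightarrow> ('c \<Rightarrow> nat) \<Rightarrow> 'c gterm \<Rightarrow> bool" where
  "gterm_ok cs car (T c ts) = (c \<in> set cs \<and> length ts = car c \<and> (\<forall>t\<in>set ts. gterm_ok cs car t))"

definition vargs :: "'c list \<Rightarrow> ('c \<Rightarrow> nat) \<Rightarrow> nat \<Rightarrow> 'c gterm list \<Rightarrow> bool" where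
  "vargs cs car n xs \<longleftrightarrow> length xs = n \<and> (\<forall>x\<in>set xs. gterm_ok cs car x)"

text \<open>gsr cs car k l f: f (with k normal and l safe arguments, given as two lists)
  is a general safe recursive function. Equations are only required on valid inputs.
  Convention for predecessors outside their intended domain: they return their argument.\<close>

inductive gsr :: "'c list \<Rightarrow> ('c \<Rightarrow> nat) \<Rightarrow> nat \<Rightarrow> nat \<Rightarrow>
    ('c gterm list \<Rightarrow> 'c gterm list \<Rightarrow> 'c gterm) \<Rightarrow> bool"
  for cs :: "'c list" and car :: "'c \<Rightarrow> nat" where
  const: "\<lbrakk> j < length cs; car (cs ! j) = 0;
      \<forall>xs ys. vargs cs car k xs \<and> vargs cs car l ys \<longrightarrow> f xs ys = T (cs ! j) [] \<rbrakk>
    \<Longrightarrow> gsr cs car k l f"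
| cons: "\<lbrakk> j < length cs;
      \<forall>ys. vargs cs car (car (cs ! j)) ys \<longrightarrow> f [] ys = T (cs ! j) ys \<rbrakk>
    \<Longrightarrow> gsr cs car 0 (car (cs ! j)) f"
| proj: "\<lbrakk> j < k + l;
      \<forall>xs ys. vargs cs car k xs \<and> vargs cs car l ys \<longrightarrow> f xs ys = (xs @ ys) ! j \<rbrakk>
    \<Longrightarrow> gsr cs car k l f"
| pred: "\<lbrakk> i < length cs; (j = 0 \<and> car (cs ! i) = 0) \<or> (1 \<le> j \<and> j \<le> car (cs ! i));
      \<forall>ts. gterm_ok cs car (T (cs ! i) ts) \<longrightarrow>
         f [] [T (cs ! i) ts] = (if j = 0 then T (cs ! i) ts else ts ! (j - 1));
      \<forall>c ts. gterm_ok cs car (T c ts) \<and> c \<noteq> cs ! i \<longrightarrow> f [] [T c ts] = T c ts \<rbrakk>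
    \<Longrightarrow> gsr cs car 0 1 f"
| cond: "\<lbrakk> \<forall>j ts zs. j < length cs \<and> gterm_ok cs car (T (cs ! j) ts) \<and> vargs cs car (length cs) zs
         \<longrightarrow> f [] (T (cs ! j) ts # zs) = zs ! j \<rbrakk>
    \<Longrightarrow> gsr cs car 0 (Suc (length cs)) f"
| comp: "\<lbrakk> gsr cs car (length js) (length gs) h; \<forall>g\<in>set gs. gsr cs car k l g;
      \<forall>j\<in>set js. j < k;
      \<forall>xs ys. vargs cs car k xs \<and> vargs cs car l ys \<longrightarrow>
         f xs ys = h (map (\<lambda>j. xs ! j) js) (map (\<lambda>g. g xs ys) gs) \<rbrakk>
    \<Longrightarrow> gsr cs car k l f"
| recur: "\<lbrakk> length hs = length cs;
      \<forall>j < length cs. gsr cs car (car (cs ! j) + k) (l + car (cs ! j)) (hs ! j);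
      \<forall>j xs ys zs. j < length cs \<and> vargs cs car (car (cs ! j)) xs \<and> vargs cs car k ys \<and> vargs cs car l zs
         \<longrightarrow> f (T (cs ! j) xs # ys) zs = (hs ! j) (xs @ ys) (zs @ map (\<lambda>x. f (x # ys) zs) xs) \<rbrakk>
    \<Longrightarrow> gsr cs car (Suc k) l f"

datatype 'c sym = Con 'c | Fn nat

text \<open>A signature: constructors cs with arities car, defined symbols dfs (names are naturals)
  with arities dar; the first dnrm f argument positions of f are normal, the rest safe.\<close>

record 'c sig =
  cons :: "'c list"
  car :: "'c \<Rightarrow> nat"
  dfs :: "nat set"
  dar :: "nat \<Rightarrow> nat"
  dnrm :: "nat \<Rightarrow> nat"

fun sar :: "'c sig \<Rightarrow> 'c sym \<Rightarrow> nat" where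
  "sar S (Con c) = car S c"
| "sar S (Fn f) = dar S f"

fun snn :: "'c sig \<Rightarrow> 'c sym \<Rightarrow> nat" where
  "snn S (Con c) = 0"
| "snn S (Fn f) = dnrm S f"

definition Fsyms :: "'c sig \<Rightarrow> 'c sym set" where
  "Fsyms S = Con ` set (cons S) \<union> Fn ` dfs S"

definition sig_ok :: "'c sig \<Rightarrow> bool" where
  "sig_ok S \<longleftrightarrow> finite (dfs S) \<and> (\<forall>f\<in>dfs S. dnrm S f \<le> dar S f)"

record 'f lgraph =
  nodes :: "nat set"
  lab :: "nat \<Rightarrow> 'f option"
  att :: "nat \<Rightarrow> nat list"

record 'f tgraph =
  gr :: "'f lgraph"
  root :: nat

definition edges :: "'f lgraph \<Rightarrow> (nat \<times> nat) set" where
  "edges g = {(v, u). v \<in> nodes g \<and> u \<in> set (att g v)}"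

definition reach :: "'f lgraph \<Rightarrow> nat \<Rightarrow> nat set" where
  "reach g v = {u. (v, u) \<in> (edges g)\<^sup>*}"

definition lgraph_ok :: "'c sig \<Rightarrow> 'c sym lgraph \<Rightarrow> bool" where
  "lgraph_ok S g \<longleftrightarrow> finite (nodes g) \<and> acyclic (edges g)
     \<and> (\<forall>v\<in>nodes g. set (att g v) \<subseteq> nodes g
          \<and> length (att g v) = (case lab g v of None \<Rightarrow> 0 | Some a \<Rightarrow> sar S a)
          \<and> (\<forall>a. lab g v = Some a \<longrightarrow> a \<in> Fsyms S))
     \<and> (\<forall>v. v \<notin> nodes g \<longrightarrow> lab g v = None \<and> att g v = [])"

definition tgraph_ok :: "'c sig \<Rightarrow> 'c sym tgraph \<Rightarrow> bool" where
  "tgraph_ok S G \<longleftrightarrow> lgraph_ok S (gr G) \<and> root G \<in> nodes (gr G) \<and> nodes (gr G) = reach (gr G) (root G)"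

definition restr :: "'f lgraph \<Rightarrow> nat \<Rightarrow> 'f tgraph" where
  "restr g v = \<lparr> gr = \<lparr> nodes = reach g v,
       lab = (\<lambda>n. if n \<in> reach g v then lab g n else None),
       att = (\<lambda>n. if n \<in> reach g v then att g n else []) \<rparr>, root = v \<rparr>"

definition sub :: "'f tgraph \<Rightarrow> nat \<Rightarrow> 'f tgraph" where
  "sub G v = restr (gr G) v"

definition gsize :: "'f tgraph \<Rightarrow> nat" where
  "gsize G = card (nodes (gr G))"

definition closed :: "'f tgraph \<Rightarrow> bool" where
  "closed G \<longleftrightarrow> (\<forall>v\<in>nodes (gr G). lab (gr G) v \<noteq> None)"

definition over_C :: "'c sig \<Rightarrow> 'c sym tgraph \<Rightarrow> bool" where
  "over_C S G \<longleftrightarrow> (\<forall>v\<in>nodes (gr G). \<forall>a. lab (gr G) v = Some a \<longrightarrow> a \<in> Con ` set (cons S))"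

definition nrm :: "'c sig \<Rightarrow> 'c sym lgraph \<Rightarrow> nat \<Rightarrow> nat list" where
  "nrm S g v = (case lab g v of None \<Rightarrow> [] | Some a \<Rightarrow> take (snn S a) (att g v))"

definition safe :: "'c sig \<Rightarrow> 'c sym lgraph \<Rightarrow> nat \<Rightarrow> nat list" where
  "safe S g v = (case lab g v of None \<Rightarrow> [] | Some a \<Rightarrow> drop (snn S a) (att g v))"

definition basic :: "'c sig \<Rightarrow> 'c sym tgraph \<Rightarrow> bool" where
  "basic S G \<longleftrightarrow> (\<exists>f\<in>dfs S. lab (gr G) (root G) = Some (Fn f))
     \<and> (\<forall>v\<in>set (att (gr G) (root G)). over_C S (sub G v))"

datatype 'f tm = Var nat | App 'f "'f tm list"

inductive repr :: "'f lgraph \<Rightarrow> nat \<Rightarrow> 'f tm \<Rightarrow> bool" for g where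
  rvar: "\<lbrakk> v \<in> nodes g; lab g v = None \<rbrakk> \<Longrightarrow> repr g v (Var v)"
| rapp: "\<lbrakk> v \<in> nodes g; lab g v = Some a; list_all2 (repr g) (att g v) ts \<rbrakk> \<Longrightarrow> repr g v (App a ts)"

definition max_shared :: "'f tgraph \<Rightarrow> bool" where
  "max_shared G \<longleftrightarrow> (\<forall>u\<in>nodes (gr G). \<forall>w\<in>nodes (gr G). \<forall>t.
      repr (gr G) u t \<and> repr (gr G) w t \<longrightarrow> u = w)"

fun emb :: "'c gterm \<Rightarrow> 'c sym tm" where
  "emb (T c ts) = App (Con c) (map emb ts)"

record 'f rule =
  rg :: "'f lgraph"
  lhs :: nat
  rhs :: nat

definition rule_ok :: "'c sig \<Rightarrow> 'c sym rule \<Rightarrow> bool" where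
  "rule_ok S R \<longleftrightarrow> lgraph_ok S (rg R) \<and> lhs R \<in> nodes (rg R) \<and> rhs R \<in> nodes (rg R)
     \<and> lhs R \<noteq> rhs R
     \<and> (\<forall>v\<in>reach (rg R) (rhs R). lab (rg R) v = None \<longrightarrow> v \<in> reach (rg R) (lhs R))"

definition lhsG :: "'f rule \<Rightarrow> 'f tgraph" where
  "lhsG R = restr (rg R) (lhs R)"

definition rhsG :: "'f rule \<Rightarrow> 'f tgraph" where
  "rhsG R = restr (rg R) (rhs R)"

definition constructor_grs :: "'c sig \<Rightarrow> 'c sym rule set \<Rightarrow> bool" where
  "constructor_grs S Gs \<longleftrightarrow> (\<forall>R\<in>Gs. rule_ok S R \<and> basic S (lhsG R))"

definition Dinf :: "'f rule set \<Rightarrow> 'f set" where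
  "Dinf Gs = {a. infinite {R\<in>Gs. lab (rg R) (lhs R) = Some a}}"

definition Ginf :: "'f rule set \<Rightarrow> 'f rule set" where
  "Ginf Gs = {R\<in>Gs. \<exists>a\<in>Dinf Gs. lab (rg R) (lhs R) = Some a}"

definition Gfin :: "'f rule set \<Rightarrow> 'f rule set" where
  "Gfin Gs = Gs - Ginf Gs"

definition hom :: "'f tgraph \<Rightarrow> 'f lgraph \<Rightarrow> (nat \<Rightarrow> nat) \<Rightarrow> bool" where
  "hom H g \<phi> \<longleftrightarrow> \<phi> ` nodes (gr H) \<subseteq> nodes g
     \<and> (\<forall>u\<in>nodes (gr H). lab (gr H) u \<noteq> None \<longrightarrow>
          lab g (\<phi> u) = lab (gr H) u \<and> att g (\<phi> u) = map \<phi> (att (gr H) u))"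

text \<open>Result of a rewrite step: build (fresh copies via psi of the nodes of K restricted to r that are
  not in K restricted to l; shared nodes mapped by phi), redirection of phi(l) to psi(r),
  garbage collection (restriction to nodes reachable from the new root).\<close>
definition step_result :: "'f rule \<Rightarrow> 'f tgraph \<Rightarrow> (nat \<Rightarrow> nat) \<Rightarrow> 'f tgraph" where
  "step_result R G \<psi> = (let K = rg R; l = lhs R; r = rhs R;
      A = reach K r - reach K l; g = gr G;
      labB = (\<lambda>n. if n \<in> nodes g then lab g n
                  else if n \<in> \<psi> ` A then lab K (the_inv_into A \<psi> n) else None);
      attB = (\<lambda>n. if n \<in> nodes g then att g n
                  else if n \<in> \<psi> ` A then map \<psi> (att K (the_inv_into A \<psi> n)) else []);
      red = (\<lambda>n. if n = \<psi> l then \<psi> r else n);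
      g' = \<lparr> nodes = nodes g \<union> \<psi> ` A, lab = labB, att = (\<lambda>n. map red (attB n)) \<rparr>
    in restr g' (red (root G)))"

definition rstep :: "'f rule set \<Rightarrow> 'f tgraph \<Rightarrow> 'f tgraph \<Rightarrow> bool" where
  "rstep Gs G H \<longleftrightarrow> (\<exists>R\<in>Gs. \<exists>\<psi>.
      hom (lhsG R) (gr G) \<psi>
      \<and> inj_on \<psi> (reach (rg R) (rhs R) - reach (rg R) (lhs R))
      \<and> \<psi> ` (reach (rg R) (rhs R) - reach (rg R) (lhs R)) \<inter> nodes (gr G) = {}
      \<and> H = step_result R G \<psi>)"

definition computes :: "'c sig \<Rightarrow> 'c sym rule set \<Rightarrow> nat \<Rightarrow> nat \<Rightarrow>
    ('c gterm list \<Rightarrow> 'c gterm list \<Rightarrow> 'c gterm) \<Rightarrow> bool" where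
  "computes S Gs k l f \<longleftrightarrow> (\<exists>fs\<in>dfs S. dar S fs = k + l \<and> dnrm S fs = k \<and>
     (\<forall>xs ys G. vargs (cons S) (car S) k xs \<and> vargs (cons S) (car S) l ys
        \<and> tgraph_ok S G \<and> closed G \<and> basic S G \<and> max_shared G
        \<and> repr (gr G) (root G) (App (Fn fs) (map emb (xs @ ys))) \<longrightarrow>
          \<not> (\<exists>s. s 0 = G \<and> (\<forall>i. rstep Gs (s i) (s (Suc i))))
        \<and> (\<forall>H. (rstep Gs)\<^sup>*\<^sup>* G H \<and> \<not> (\<exists>H'. rstep Gs H H') \<longrightarrow>
             closed H \<and> over_C S H \<and> repr (gr H) (root H) (emb (f xs ys)))))"

definition precedence :: "'c sym rel \<Rightarrow> bool" where
  "precedence P \<longleftrightarrow> wf P \<and> trans P \<and> (\<forall>a c. (a, Con c) \<notin> P)"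

definition nrm_sub :: "'c sig \<Rightarrow> 'c sym tgraph \<Rightarrow> 'c sym tgraph \<Rightarrow> bool" where
  "nrm_sub S H G \<longleftrightarrow> (\<exists>v\<in>set (nrm S (gr G) (root G)). \<exists>u\<in>nodes (gr (sub G v)). H = sub (sub G v) u)"

inductive pt :: "'c sig \<Rightarrow> 'c sym rel \<Rightarrow> 'c sym tgraph \<Rightarrow> 'c sym tgraph \<Rightarrow> bool" for S P where
  pt1: "\<lbrakk> \<forall>v\<in>nodes (gr H). \<forall>a. lab (gr H) v = Some a \<longrightarrow> (\<exists>b. lab (gr G) (root G) = Some b \<and> (a, b) \<in> P);
      u \<in> set (att (gr G) (root G)); H = sub G u \<or> pt S P H (sub G u) \<rbrakk> \<Longrightarrow> pt S P H G"
| pt2: "\<lbrakk> \<forall>v\<in>nodes (gr H). \<forall>a. lab (gr H) v = Some a \<longrightarrow> (\<exists>b. lab (gr G) (root G) = Some b \<and> (a, b) \<in> P);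
      lab (gr H) (root H) \<noteq> None;
      \<forall>v\<in>set (nrm S (gr H) (root H)). nrm_sub S (sub H v) G;
      \<forall>v\<in>set (safe S (gr H) (root H)). pt S P (sub H v) G \<rbrakk> \<Longrightarrow> pt S P H G"

definition pt_sep :: "'c sig \<Rightarrow> 'c sym rule set \<Rightarrow> bool" where
  "pt_sep S Gs \<longleftrightarrow> (\<exists>P. precedence P \<and> (\<forall>R\<in>Gs. pt S P (rhsG R) (lhsG R)))"

definition cap_nrm :: "'c sig \<Rightarrow> 'c sym tgraph \<Rightarrow> 'c sym tgraph" where
  "cap_nrm S G = (let g = gr G; \<rho> = root G; ns = nrm S g \<rho>; ss = safe S g \<rho>;
      N = (\<Union>v\<in>set ns. reach g v); m = Suc (Max (nodes g)); fr = [m..<m + length ss]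
    in if (\<forall>v\<in>set ss. lab g v = None) then G
       else \<lparr> gr = \<lparr> nodes = {\<rho>} \<union> N \<union> set fr,
                   lab = (\<lambda>n. if n = \<rho> then lab g \<rho> else if n \<in> N then lab g n else None),
                   att = (\<lambda>n. if n = \<rho> then ns @ fr else if n \<in> N then att g n else []) \<rparr>,
              root = \<rho> \<rparr>)"

definition inf_rule_conds :: "'c sig \<Rightarrow> nat \<Rightarrow> 'c sym rule \<Rightarrow> bool" where
  "inf_rule_conds S d R \<longleftrightarrow> (let K = rg R; l = lhs R; r = rhs R in
      max_shared (cap_nrm S (restr K l))
    \<and> (\<forall>v\<in>set (nrm S K l). lab K v \<noteq> None \<longrightarrow> closed (restr K v))
    \<and> card ({v\<in>set (nrm S K l). lab K v = None} \<union> (\<Union>v\<in>set (safe S K l). reach K v)) \<le> d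
    \<and> gsize (restr K r) \<le> gsize (restr K l) + card (\<Union>v\<in>set (nrm S K r). reach K v))"

end

theory Submission
  imports Defs "HOL-Library.Multiset" "HOL-Library.Countable_Set"
begin

text \<open>
  A derivation of \<open>f\<close> is turned into a program: a list of function symbols, each defined from earlier
  ones. Only recursion needs infinitely many rules. The rule for the recursion argument \<open>t\<close> rewrites
  \<open>f(t, ys; zs)\<close> in one step to the complete unfolding of the recursion along the maximally shared graph
  of \<open>t\<close>, with one \<open>h\<close>-node for each distinct subterm of \<open>t\<close>. The right-hand side mentions only earlier
  symbols, and its normal arguments are subterms of normal arguments of the left-hand side. Its nodes are
  the \<open>h\<close>-nodes, proper subterms of \<open>t\<close> (all below its normal arguments) and variables, which gives the
  size bound (iv).

  Along a rewrite sequence all normal arguments stay inside the input graph, which is maximally shared,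
  so some recursion rule always matches at an innermost redex. Each step replaces a symbol by earlier
  ones, hence the multiset of labels decreases, and it preserves a valuation of the nodes by ground terms.
\<close>

section \<open>Labeled graphs\<close>

lemma reach_refl [simp]: "v \<in> reach g v"
  by (simp add: reach_def)

lemma reach_trans: "u \<in> reach g v \<Longrightarrow> w \<in> reach g u \<Longrightarrow> w \<in> reach g v"
  by (simp add: reach_def)

lemma reach_successor: "u \<in> reach g v \<Longrightarrow> u \<in> nodes g \<Longrightarrow> w \<in> set (att g u) \<Longrightarrow> w \<in> reach g v"
  by (auto simp: reach_def edges_def intro: rtrancl_into_rtrancl)

lemma reach_subset:
  assumes "v \<in> V" and "\<And>w. w \<in> V \<Longrightarrow> w \<in> nodes g \<Longrightarrow> set (att g w) \<subseteq> V"
  shows "reach g v \<subseteq> V"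
proof
  fix u assume "u \<in> reach g v"
  then have "(v, u) \<in> (edges g)\<^sup>*" by (simp add: reach_def)
  then show "u \<in> V"
    by induction (use assms in \<open>auto simp: edges_def\<close>)
qed

lemma lgraph_okD:
  assumes "lgraph_ok S g" and "v \<in> nodes g"
  shows "set (att g v) \<subseteq> nodes g"
    and "lab g v = Some a \<Longrightarrow> a \<in> Fsyms S"
    and "lab g v = Some a \<Longrightarrow> length (att g v) = sar S a"
  using assms by (auto simp: lgraph_ok_def)

lemma reach_subset_nodes: "lgraph_ok S g \<Longrightarrow> v \<in> nodes g \<Longrightarrow> reach g v \<subseteq> nodes g"
  by (rule reach_subset) (auto dest: lgraph_okD)

lemma wf_edges_converse:
  assumes "lgraph_ok S g"
  shows "wf ((edges g)\<inverse>)"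
proof -
  have "edges g \<subseteq> nodes g \<times> nodes g"
    using lgraph_okD(1)[OF assms] by (auto simp: edges_def)
  then have "finite (edges g)"
    using assms by (auto simp: lgraph_ok_def intro: finite_subset)
  then show ?thesis
    using assms by (simp add: lgraph_ok_def finite_acyclic_wf_converse)
qed

lemma nodes_restr [simp]: "nodes (gr (restr g v)) = reach g v"
  and root_restr [simp]: "root (restr g v) = v"
  and lab_restr [simp]: "u \<in> reach g v \<Longrightarrow> lab (gr (restr g v)) u = lab g u"
  and att_restr [simp]: "u \<in> reach g v \<Longrightarrow> att (gr (restr g v)) u = att g u"
  by (simp_all add: restr_def)

lemma edges_restr:
  assumes "reach g v \<subseteq> nodes g"
  shows "edges (gr (restr g v)) = edges g \<inter> reach g v \<times> UNIV"
  using assms by (auto simp: edges_def)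

lemma reach_restr:
  assumes "reach g v \<subseteq> nodes g" and "u \<in> reach g v"
  shows "reach (gr (restr g v)) u = reach g u"
proof
  have "edges (gr (restr g v)) \<subseteq> edges g" using edges_restr[OF assms(1)] by blast
  then show "reach (gr (restr g v)) u \<subseteq> reach g u"
    unfolding reach_def using rtrancl_mono by blast
next
  have "set (att g w) \<subseteq> reach (gr (restr g v)) u"
    if "w \<in> reach (gr (restr g v)) u \<inter> reach g v" for w
    using that reach_successor[of w "gr (restr g v)" u] by auto
  then have "reach g u \<subseteq> reach (gr (restr g v)) u \<inter> reach g v"
    using assms by (intro reach_subset) (auto intro: reach_successor)
  then show "reach g u \<subseteq> reach (gr (restr g v)) u" by blast
qed

lemma sub_restr:
  assumes "reach g v \<subseteq> nodes g" and "u \<in> reach g v"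
  shows "sub (restr g v) u = restr g u"
proof -
  have "reach g u \<subseteq> reach g v" using assms(2) reach_trans by blast
  then have "lab (gr (sub (restr g v) u)) = lab (gr (restr g u))"
    and "att (gr (sub (restr g v) u)) = att (gr (restr g u))"
    using reach_restr[OF assms] by (auto simp: sub_def restr_def fun_eq_iff)
  then show ?thesis
    using reach_restr[OF assms] by (simp add: sub_def restr_def)
qed

lemma tgraph_ok_restr:
  assumes ok: "lgraph_ok S g" and v: "v \<in> nodes g"
  shows "tgraph_ok S (restr g v)"
proof -
  have reach: "reach g v \<subseteq> nodes g" using ok v by (rule reach_subset_nodes)
  have "acyclic (edges (gr (restr g v)))"
    using ok edges_restr[OF reach] by (auto simp: lgraph_ok_def intro: acyclic_subset)
  moreover have "finite (reach g v)"
    using ok reach by (auto simp: lgraph_ok_def intro: finite_subset)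
  moreover have "set (att g u) \<subseteq> reach g v
      \<and> length (att g u) = (case lab g u of None \<Rightarrow> 0 | Some a \<Rightarrow> sar S a)
      \<and> (\<forall>a. lab g u = Some a \<longrightarrow> a \<in> Fsyms S)" if "u \<in> reach g v" for u
    using that ok reach reach_successor[of u g v] by (auto simp: lgraph_ok_def)
  ultimately have "lgraph_ok S (gr (restr g v))"
    unfolding lgraph_ok_def by (simp add: restr_def)
  then show ?thesis
    using reach_restr[OF reach reach_refl] by (simp add: tgraph_ok_def)
qed

lemma repr_functional: "repr g v s \<Longrightarrow> repr g v t \<Longrightarrow> s = t"
proof (induction arbitrary: t rule: repr.induct)
  case (rvar v)
  then show ?case by (auto elim: repr.cases)
next
  case (rapp v a ts)
  from rapp.prems obtain us where us: "t = App a us" "list_all2 (repr g) (att g v) us"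
    using rapp.hyps(2) by (auto elim: repr.cases)
  then have "ts = us"
    using rapp.IH by (auto simp: list_all2_conv_all_nth intro!: nth_equalityI)
  then show ?case using us by simp
qed

lemma repr_total:
  assumes ok: "lgraph_ok S g"
  shows "v \<in> nodes g \<Longrightarrow> \<exists>t. repr g v t"
  using wf_edges_converse[OF ok]
proof (induction v rule: wf_induct_rule)
  case (less v)
  show ?case
  proof (cases "lab g v")
    case None
    then show ?thesis using less.prems by (blast intro: rvar)
  next
    case (Some a)
    have "\<forall>u\<in>set (att g v). \<exists>t. repr g u t"
      using less lgraph_okD(1)[OF ok] by (auto simp: edges_def)
    then obtain f where "\<forall>u\<in>set (att g v). repr g u (f u)" by (rule bchoice[THEN exE])
    then have "list_all2 (repr g) (att g v) (map f (att g v))"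
      by (simp add: list_all2_map2 list_all2_same)
    then show ?thesis using less.prems Some by (blast intro: rapp)
  qed
qed

lemma max_sharedI:
  assumes "\<And>u w a. u \<in> nodes (gr G) \<Longrightarrow> w \<in> nodes (gr G) \<Longrightarrow> lab (gr G) u = Some a \<Longrightarrow>
    lab (gr G) w = Some a \<Longrightarrow> att (gr G) u = att (gr G) w \<Longrightarrow> u = w"
  shows "max_shared G"
proof -
  have "repr (gr G) u t \<Longrightarrow> repr (gr G) w t \<Longrightarrow> u = w" for u w t
  proof (induction arbitrary: w rule: repr.induct)
    case (rvar u)
    then show ?case by (auto elim: repr.cases)
  next
    case (rapp u a ts)
    from rapp.prems have w: "w \<in> nodes (gr G)" "lab (gr G) w = Some a"
      "list_all2 (repr (gr G)) (att (gr G) w) ts"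
      by (auto elim: repr.cases)
    then have "att (gr G) u = att (gr G) w"
      using rapp.IH by (auto simp: list_all2_conv_all_nth intro!: nth_equalityI)
    then show ?case using assms rapp.hyps w by blast
  qed
  then show ?thesis by (auto simp: max_shared_def)
qed

section \<open>Terms and their maximally shared graphs\<close>

fun subterms :: "'f tm \<Rightarrow> 'f tm set" where
  "subterms (Var x) = {Var x}"
| "subterms (App a ts) = insert (App a ts) (\<Union>t\<in>set ts. subterms t)"

fun vars :: "'f tm \<Rightarrow> nat set" where
  "vars (Var x) = {x}"
| "vars (App a ts) = (\<Union>t\<in>set ts. vars t)"

fun tm_lab :: "'f tm \<Rightarrow> 'f option" where
  "tm_lab (Var x) = None"
| "tm_lab (App a ts) = Some a"

fun tm_att :: "'f tm \<Rightarrow> 'f tm list" where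
  "tm_att (Var x) = []"
| "tm_att (App a ts) = ts"

fun tm_ok :: "'c sig \<Rightarrow> 'c sym tm \<Rightarrow> bool" where
  "tm_ok S (Var x) = True"
| "tm_ok S (App a ts) = (a \<in> Fsyms S \<and> length ts = sar S a \<and> (\<forall>t\<in>set ts. tm_ok S t))"

fun eval :: "('f \<Rightarrow> 'a list \<Rightarrow> 'a) \<Rightarrow> (nat \<Rightarrow> 'a) \<Rightarrow> 'f tm \<Rightarrow> 'a" where
  "eval I \<sigma> (Var x) = \<sigma> x"
| "eval I \<sigma> (App a ts) = I a (map (eval I \<sigma>) ts)"

lemma subterms_refl [simp]: "t \<in> subterms t"
  by (cases t) auto

lemma arg_in_subterms: "t \<in> set ts \<Longrightarrow> t \<in> subterms (App a ts)"
  by (auto intro: bexI[of _ t])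

lemma finite_subterms [simp]: "finite (subterms t)"
  by (induction t) auto

lemma subterms_subset: "s \<in> subterms t \<Longrightarrow> subterms s \<subseteq> subterms t"
proof (induction t)
  case (App a ts)
  then show ?case by (cases "s = App a ts") fastforce+
qed simp

lemma tm_att_subset_subterms: "set (tm_att t) \<subseteq> subterms t"
  by (cases t) (auto simp del: subterms.simps intro: arg_in_subterms)

lemma size_tm_att: "s \<in> set (tm_att t) \<Longrightarrow> size s < size t"
  by (cases t) (auto simp: less_Suc_eq_le size_list_estimation')

lemma finite_vars: "finite (vars t)"
  by (induction t) auto

lemma in_vars_iff: "x \<in> vars t \<longleftrightarrow> Var x \<in> subterms t"
  by (induction t) auto

lemma size_subterm: "s \<in> subterms t \<Longrightarrow> size s \<le> size t"
proof (induction t)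
  case (App a ts)
  then show ?case using size_tm_att[of _ "App a ts"] by fastforce
qed simp

lemma vars_subterm: "s \<in> subterms t \<Longrightarrow> vars s \<subseteq> vars t"
  using subterms_subset[of s t] by (auto simp: in_vars_iff)

lemma set_tm_subterm: "s \<in> subterms t \<Longrightarrow> set_tm s \<subseteq> set_tm t"
  by (induction t) auto

lemma set_tm_if_tm_lab: "s \<in> subterms t \<Longrightarrow> tm_lab s = Some a \<Longrightarrow> a \<in> set_tm t"
  using set_tm_subterm[of s t] by (cases s) auto

lemma tm_lab_eq_None_iff: "tm_lab t = None \<longleftrightarrow> (\<exists>x. t = Var x)"
  by (cases t) auto

lemma tm_eqI: "tm_lab s = Some a \<Longrightarrow> tm_lab t = Some a \<Longrightarrow> tm_att s = tm_att t \<Longrightarrow> s = t"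
  by (cases s; cases t) auto

lemma tm_ok_subterm: "tm_ok S t \<Longrightarrow> s \<in> subterms t \<Longrightarrow> tm_ok S s"
  by (induction t) auto

lemma set_tm_subset_Fsyms: "tm_ok S t \<Longrightarrow> set_tm t \<subseteq> Fsyms S"
  by (induction t) auto

lemma eval_cong: "(\<And>x. x \<in> vars t \<Longrightarrow> \<sigma> x = \<tau> x) \<Longrightarrow> eval I \<sigma> t = eval I \<tau> t"
proof (induction t)
  case (App a ts)
  then have "map (eval I \<sigma>) ts = map (eval I \<tau>) ts" by auto
  then show ?case by (simp del: map_eq_conv)
qed simp

definition tm_graph :: "('f tm \<Rightarrow> nat) \<Rightarrow> 'f tm set \<Rightarrow> 'f lgraph" where
  "tm_graph e W = \<lparr> nodes = e ` W,
     lab = (\<lambda>n. if n \<in> e ` W then tm_lab (inv_into W e n) else None),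
     att = (\<lambda>n. if n \<in> e ` W then map e (tm_att (inv_into W e n)) else []) \<rparr>"

locale tm_coding =
  fixes e :: "'c sym tm \<Rightarrow> nat" and W :: "'c sym tm set"
  assumes inj_code: "inj_on e W" and subterm_closed: "t \<in> W \<Longrightarrow> subterms t \<subseteq> W"
begin

abbreviation K :: "'c sym lgraph" where
  "K \<equiv> tm_graph e W"

lemma nodes_tm_graph [simp]: "nodes K = e ` W"
  and lab_tm_graph [simp]: "t \<in> W \<Longrightarrow> lab K (e t) = tm_lab t"
  and att_tm_graph [simp]: "t \<in> W \<Longrightarrow> att K (e t) = map e (tm_att t)"
  using inj_code by (simp_all add: tm_graph_def)

lemma code_eq_iff: "s \<in> W \<Longrightarrow> t \<in> W \<Longrightarrow> e s = e t \<longleftrightarrow> s = t"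
  using inj_code by (auto dest: inj_onD)

lemma tm_att_closed: "t \<in> W \<Longrightarrow> set (tm_att t) \<subseteq> W"
  using subterm_closed tm_att_subset_subterms by blast

lemma args_closed: "App a ts \<in> W \<Longrightarrow> t \<in> set ts \<Longrightarrow> t \<in> W"
  using tm_att_closed[of "App a ts"] by auto

lemma inj_on_code_subterms: "t \<in> W \<Longrightarrow> inj_on e (subterms t)"
  using inj_code subterm_closed inj_on_subset by blast

lemma reach_tm_graph:
  assumes "t \<in> W"
  shows "reach K (e t) = e ` subterms t"
proof
  show "reach K (e t) \<subseteq> e ` subterms t"
  proof (rule reach_subset)
    fix n assume "n \<in> e ` subterms t"
    then obtain s where s: "s \<in> subterms t" "n = e s" by auto
    then have "s \<in> W" using subterm_closed[OF assms] by blast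
    then show "set (att K n) \<subseteq> e ` subterms t"
      using s tm_att_subset_subterms[of s] subterms_subset[of s t] by auto
  qed simp
next
  have "e s \<in> reach K (e t)" if "s \<in> subterms t" for s
    using that assms
  proof (induction t)
    case (App a ts)
    show ?case
    proof (cases "s = App a ts")
      case False
      then obtain u where u: "u \<in> set ts" "s \<in> subterms u" using App.prems by auto
      then have "u \<in> W" using App.prems(2) by (simp add: args_closed)
      with u have "e s \<in> reach K (e u)" by (rule App.IH)
      moreover have "e u \<in> reach K (e (App a ts))"
        using u App.prems(2) by (intro reach_successor[OF reach_refl]) auto
      ultimately show ?thesis by (rule reach_trans[rotated])
    qed simp
  qed simp
  then show "e ` subterms t \<subseteq> reach K (e t)" by auto
qed

lemma reach_tm_graph_subset_nodes: "t \<in> W \<Longrightarrow> reach K (e t) \<subseteq> nodes K"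
  using subterm_closed by (auto simp: reach_tm_graph)

lemma sub_restr_tm_graph: "t \<in> W \<Longrightarrow> s \<in> subterms t \<Longrightarrow> sub (restr K (e t)) (e s) = restr K (e s)"
  by (rule sub_restr[OF reach_tm_graph_subset_nodes]) (simp_all add: reach_tm_graph)

lemma nodes_restr_tm_graph: "t \<in> W \<Longrightarrow> nodes (gr (restr K (e t))) = e ` subterms t"
  by (simp add: reach_tm_graph)

lemma lab_restr_tm_graph: "t \<in> W \<Longrightarrow> s \<in> subterms t \<Longrightarrow> lab (gr (restr K (e t))) (e s) = tm_lab s"
  and att_restr_tm_graph: "t \<in> W \<Longrightarrow> s \<in> subterms t \<Longrightarrow> att (gr (restr K (e t))) (e s) = map e (tm_att s)"
  using subsetD[OF subterm_closed] by (simp_all add: reach_tm_graph)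

lemma gsize_restr_tm_graph: "t \<in> W \<Longrightarrow> gsize (restr K (e t)) = card (subterms t)"
  using inj_on_code_subterms by (simp add: gsize_def reach_tm_graph card_image)

lemma max_shared_restr_tm_graph:
  assumes "t \<in> W"
  shows "max_shared (restr K (e t))"
proof (rule max_sharedI)
  fix u w a
  assume "u \<in> nodes (gr (restr K (e t)))" "w \<in> nodes (gr (restr K (e t)))"
  then obtain r s where rs: "r \<in> subterms t" "u = e r" "s \<in> subterms t" "w = e s"
    using assms by (auto simp: reach_tm_graph)
  then have W: "r \<in> W" "s \<in> W" using subterm_closed[OF assms] by auto
  assume "lab (gr (restr K (e t))) u = Some a" "lab (gr (restr K (e t))) w = Some a"
    and att: "att (gr (restr K (e t))) u = att (gr (restr K (e t))) w"
  then have "tm_lab r = Some a" "tm_lab s = Some a"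
    using rs assms by (auto simp: lab_restr_tm_graph)
  moreover have "map e (tm_att r) = map e (tm_att s)"
    using att rs assms by (simp add: att_restr_tm_graph)
  then have "tm_att r = tm_att s"
    using inj_code W tm_att_closed by (intro map_inj_on[where f = e]) (auto intro: inj_on_subset)
  ultimately have "r = s" by (rule tm_eqI)
  then show "u = w" using rs by simp
qed

lemma lgraph_ok_tm_graph:
  assumes "finite W" and wf: "\<And>t. t \<in> W \<Longrightarrow> tm_ok S t"
  shows "lgraph_ok S K"
proof -
  have "(edges K)\<inverse> \<subseteq> measure (\<lambda>n. size (inv_into W e n))"
    using inj_code tm_att_closed by (auto simp: edges_def size_tm_att subset_iff)
  then have "acyclic (edges K)"
    using wf_acyclic wf_subset[OF wf_measure] acyclic_converse by blast
  moreover have "length (tm_att t) = (case tm_lab t of None \<Rightarrow> 0 | Some a \<Rightarrow> sar S a)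
     \<and> (\<forall>a. tm_lab t = Some a \<longrightarrow> a \<in> Fsyms S)" if "t \<in> W" for t
    using wf[OF that] by (cases t) auto
  ultimately show ?thesis
    using assms(1) tm_att_closed unfolding lgraph_ok_def
    by (auto simp: image_mono) (auto simp: tm_graph_def)
qed

lemma over_C_restr_tm_graph:
  assumes "t \<in> W" and "set_tm t \<subseteq> Con ` set (cons S)"
  shows "over_C S (restr K (e t))"
  using assms set_tm_if_tm_lab[of _ t]
  by (auto simp: over_C_def nodes_restr_tm_graph lab_restr_tm_graph simp del: nodes_restr)

lemma nrm_tm_graph: "App a ts \<in> W \<Longrightarrow> nrm S K (e (App a ts)) = map e (take (snn S a) ts)"
  and safe_tm_graph: "App a ts \<in> W \<Longrightarrow> safe S K (e (App a ts)) = map e (drop (snn S a) ts)"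
  by (simp_all add: nrm_def safe_def take_map drop_map)

lemma nrm_restr_tm_graph: "App a ts \<in> W \<Longrightarrow>
    nrm S (gr (restr K (e (App a ts)))) (e (App a ts)) = map e (take (snn S a) ts)"
  and safe_restr_tm_graph: "App a ts \<in> W \<Longrightarrow>
    safe S (gr (restr K (e (App a ts)))) (e (App a ts)) = map e (drop (snn S a) ts)"
  by (simp_all add: nrm_def safe_def take_map drop_map)

lemma card_reach_tm_graph_Union:
  assumes "A \<subseteq> W"
  shows "card (\<Union>t\<in>A. reach K (e t)) = card (\<Union> (subterms ` A))"
proof -
  have "\<Union> (subterms ` A) \<subseteq> W" using assms subterm_closed by blast
  then have "inj_on e (\<Union> (subterms ` A))" by (rule inj_on_subset[OF inj_code])
  moreover have "(\<Union>t\<in>A. reach K (e t)) = e ` \<Union> (subterms ` A)"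
    using assms by (simp add: reach_tm_graph image_UN subset_iff)
  ultimately show ?thesis by (simp add: card_image)
qed

end

section \<open>Precedence termination on terms\<close>

text \<open>The label condition of \<^const>\<open>pt\<close> is left out: on the right-hand sides considered here it
  holds for all subterms alike.\<close>

inductive tm_pt :: "'c sig \<Rightarrow> nat \<Rightarrow> 'c sym tm list \<Rightarrow> 'c sym tm \<Rightarrow> bool" for S k args where
  arg: "t \<in> set args \<Longrightarrow> tm_pt S k args t"
| var: "t \<in> set args \<Longrightarrow> x \<in> vars t \<Longrightarrow> tm_pt S k args (Var x)"
| app: "\<forall>t\<in>set (take (snn S a) ts). \<exists>s\<in>set (take k args). t \<in> subterms s \<Longrightarrow>
    \<forall>t\<in>set (drop (snn S a) ts). tm_pt S k args t \<Longrightarrow> tm_pt S k args (App a ts)"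

lemma tm_pt_normal_args:
  assumes "tm_pt S k args R" and "App a ts \<in> subterms R" and "\<And>s. s \<in> set args \<Longrightarrow> App a ts \<notin> subterms s"
    and "t \<in> set (take (snn S a) ts)"
  shows "\<exists>s\<in>set (take k args). t \<in> subterms s"
  using assms
proof (induction rule: tm_pt.induct)
  case (app b us)
  show ?case
  proof (cases "App a ts = App b us")
    case True
    then show ?thesis using app.hyps app.prems by simp
  next
    case False
    then obtain u where u: "u \<in> set us" "App a ts \<in> subterms u" using app.prems by auto
    moreover have "u \<notin> set (take (snn S b) us)"
    proof
      assume "u \<in> set (take (snn S b) us)"
      then obtain s where "s \<in> set (take k args)" "u \<in> subterms s" using app.hyps by blast
      then show False using u(2) app.prems(2) subterms_subset in_set_takeD by (metis subsetD)
    qed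
    ultimately have "u \<in> set (drop (snn S b) us)"
      by (metis UnE append_take_drop_id set_append)
    then show ?thesis using app u(2) by blast
  qed
qed auto

context tm_coding
begin

lemma pt_restr_tm_graph_Var:
  "t \<in> W \<Longrightarrow> x \<in> vars t \<Longrightarrow> t \<noteq> Var x \<Longrightarrow> pt S P (restr K (e (Var x))) (restr K (e t))"
proof (induction t)
  case (App a ts)
  then obtain u where u: "u \<in> set ts" "x \<in> vars u" by auto
  have usub: "u \<in> subterms (App a ts)" using u(1) by (rule arg_in_subterms)
  then have uW: "u \<in> W" using App.prems(1) u(1) by (simp add: args_closed)
  have xW: "Var x \<in> W" using u(2) uW subterm_closed by (auto simp: in_vars_iff)
  show ?case
  proof (rule pt1)
    show "e u \<in> set (att (gr (restr K (e (App a ts)))) (root (restr K (e (App a ts)))))"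
      using App.prems(1) u(1) by simp
    show "restr K (e (Var x)) = sub (restr K (e (App a ts))) (e u)
        \<or> pt S P (restr K (e (Var x))) (sub (restr K (e (App a ts))) (e u))"
      unfolding sub_restr_tm_graph[OF App.prems(1) usub] using App.IH[OF u(1) uW u(2)] by blast
  qed (use xW in \<open>simp add: reach_tm_graph\<close>)
qed simp

lemma labels_restr_tm_graph_below:
  assumes "R \<in> W" and "App f args \<in> W" and "set_tm R \<subseteq> {a. (a, f) \<in> P}"
  shows "\<forall>v\<in>nodes (gr (restr K (e R))). \<forall>a. lab (gr (restr K (e R))) v = Some a \<longrightarrow>
    (\<exists>b. lab (gr (restr K (e (App f args)))) (root (restr K (e (App f args)))) = Some b \<and> (a, b) \<in> P)"
proof -
  have "(a, f) \<in> P" if "t \<in> subterms R" "tm_lab t = Some a" for t a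
    using assms(3) set_tm_if_tm_lab[OF that] by auto
  then show ?thesis
    using assms(1,2) subterm_closed[OF assms(1)] by (auto simp: reach_tm_graph)
qed

lemma nrm_sub_restr_tm_graph:
  assumes "App f args \<in> W" and "s \<in> set (take (snn S f) args)" and "t \<in> subterms s"
  shows "nrm_sub S (restr K (e t)) (restr K (e (App f args)))"
proof -
  have sarg: "s \<in> set args" using assms(2) by (rule in_set_takeD)
  then have sub: "s \<in> subterms (App f args)" by (rule arg_in_subterms)
  have sW: "s \<in> W" using assms(1) sarg by (rule args_closed)
  have "e s \<in> set (nrm S (gr (restr K (e (App f args)))) (root (restr K (e (App f args)))))"
    using assms(1,2) by (simp add: nrm_restr_tm_graph)
  moreover have "sub (restr K (e (App f args))) (e s) = restr K (e s)"
    using assms(1) sub by (rule sub_restr_tm_graph)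
  moreover have "restr K (e t) = sub (restr K (e s)) (e t)"
    using sW assms(3) by (rule sub_restr_tm_graph[symmetric])
  moreover have "e t \<in> nodes (gr (restr K (e s)))"
    using sW assms(3) by (simp add: reach_tm_graph)
  ultimately show ?thesis unfolding nrm_sub_def by metis
qed

lemma pt_restr_tm_graph_App:
  assumes L: "App f args \<in> W" and R: "App a ts \<in> W" and below: "set_tm (App a ts) \<subseteq> {a. (a, f) \<in> P}"
    and normal: "\<And>t. t \<in> set (take (snn S a) ts) \<Longrightarrow> \<exists>s\<in>set (take (snn S f) args). t \<in> subterms s"
    and safe: "\<And>t. t \<in> set (drop (snn S a) ts) \<Longrightarrow> pt S P (restr K (e t)) (restr K (e (App f args)))"
  shows "pt S P (restr K (e (App a ts))) (restr K (e (App f args)))" (is "pt S P ?H ?G")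
proof (rule pt2[OF labels_restr_tm_graph_below[OF R L below]])
  have sub: "sub ?H (e t) = restr K (e t)" if "t \<in> set ts" for t
    using R arg_in_subterms[OF that] by (rule sub_restr_tm_graph)
  show "lab (gr ?H) (root ?H) \<noteq> None"
    using R by simp
  show "\<forall>v\<in>set (nrm S (gr ?H) (root ?H)). nrm_sub S (sub ?H v) ?G"
  proof
    fix v assume "v \<in> set (nrm S (gr ?H) (root ?H))"
    then obtain t where t: "t \<in> set (take (snn S a) ts)" "v = e t"
      using R by (auto simp: nrm_restr_tm_graph)
    then obtain s where "s \<in> set (take (snn S f) args)" "t \<in> subterms s"
      using normal by blast
    then show "nrm_sub S (sub ?H v) ?G"
      using L sub t in_set_takeD by (metis nrm_sub_restr_tm_graph)
  qed
  show "\<forall>v\<in>set (safe S (gr ?H) (root ?H)). pt S P (sub ?H v) ?G"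
    using R safe sub[OF in_set_dropD] by (auto simp: safe_restr_tm_graph)
qed

lemma pt_restr_tm_graph:
  assumes "tm_pt S (snn S f) args R" and L: "App f args \<in> W"
    and "R \<in> W" and "set_tm R \<subseteq> {a. (a, f) \<in> P}"
  shows "pt S P (restr K (e R)) (restr K (e (App f args)))"
  using assms(1,3,4)
proof (induction rule: tm_pt.induct)
  case (arg t)
  have "e t \<in> set (att (gr (restr K (e (App f args)))) (root (restr K (e (App f args)))))"
    using arg.hyps L by simp
  with labels_restr_tm_graph_below[OF arg.prems(1) L arg.prems(2)] show ?case
    using sub_restr_tm_graph[OF L arg_in_subterms[OF arg.hyps]] by (rule pt1[OF _ _ disjI1[OF sym]])
next
  case (var t x)
  then have "x \<in> vars (App f args)" by auto
  with L show ?case by (rule pt_restr_tm_graph_Var) simp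
next
  case (app a ts)
  have args: "t \<in> W" "set_tm t \<subseteq> {a. (a, f) \<in> P}" if "t \<in> set (drop (snn S a) ts)" for t
    using in_set_dropD[OF that] app.prems args_closed by auto
  show ?case
    using app.hyps app.IH args by (intro pt_restr_tm_graph_App[OF L app.prems]) blast+
qed

end

section \<open>Rules given by pairs of terms\<close>

context tm_coding
begin

lemma basic_restr_tm_graph:
  assumes L: "App (Fn f) args \<in> W" and "f \<in> dfs S"
    and args: "\<And>t. t \<in> set args \<Longrightarrow> set_tm t \<subseteq> Con ` set (cons S)"
  shows "basic S (restr K (e (App (Fn f) args)))"
proof -
  have "over_C S (sub (restr K (e (App (Fn f) args))) (e t))" if "t \<in> set args" for t
    unfolding sub_restr_tm_graph[OF L arg_in_subterms[OF that]]
    using L that args by (simp add: over_C_restr_tm_graph args_closed)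
  then show ?thesis
    using L assms(2) by (auto simp: basic_def)
qed

lemma max_shared_cap_nrm_restr_tm_graph:
  assumes L: "App f args \<in> W" and "set (drop (snn S f) args) \<subseteq> range Var"
  shows "max_shared (cap_nrm S (restr K (e (App f args))))"
proof -
  let ?G = "restr K (e (App f args))"
  have "lab (gr ?G) (e s) = None" if "s \<in> set (drop (snn S f) args)" for s
  proof -
    have "s \<in> set args" using that by (rule in_set_dropD)
    then have "lab (gr ?G) (e s) = tm_lab s" using L by (intro lab_restr_tm_graph arg_in_subterms)
    then show ?thesis using that assms(2) by auto
  qed
  then have "cap_nrm S ?G = ?G"
    using L by (auto simp: cap_nrm_def safe_restr_tm_graph)
  then show ?thesis
    using max_shared_restr_tm_graph[OF L] by simp
qed

lemma closed_restr_tm_graph: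
  assumes "t \<in> W" and "vars t = {}"
  shows "closed (restr K (e t))"
proof -
  have "tm_lab s \<noteq> None" if "s \<in> subterms t" for s
    using that assms(2) by (auto simp: in_vars_iff tm_lab_eq_None_iff)
  then show ?thesis
    using assms(1) subterm_closed[OF assms(1)] by (auto simp: closed_def reach_tm_graph)
qed

lemma card_unlabeled_or_safe_args_le:
  assumes L: "App f args \<in> W" and "set (drop (snn S f) args) \<subseteq> range Var"
  shows "card ({v\<in>set (nrm S K (e (App f args))). lab K v = None}
    \<union> (\<Union>v\<in>set (safe S K (e (App f args))). reach K v)) \<le> card (vars (App f args))"
proof -
  let ?N = "set (take (snn S f) args)" and ?S = "set (drop (snn S f) args)"
  have W: "?N \<subseteq> W" "?S \<subseteq> W"
    using args_closed[OF L] by (auto dest: in_set_takeD in_set_dropD)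
  have unlabeled: "s \<in> Var ` vars (App f args)" if "s \<in> ?N \<union> ?S" and None: "tm_lab s = None" for s
  proof -
    obtain x where x: "s = Var x" using None by (auto simp: tm_lab_eq_None_iff)
    have "s \<in> set args" using that by (auto dest: in_set_takeD in_set_dropD)
    then have "x \<in> vars (App f args)"
      unfolding x by (rule vars_subterm[OF arg_in_subterms, THEN subsetD]) simp
    then show ?thesis unfolding x by (rule imageI)
  qed
  then have nrm: "{v\<in>e ` ?N. lab K v = None} \<subseteq> e ` Var ` vars (App f args)"
    using W(1) by auto
  have safe: "reach K (e s) \<subseteq> e ` Var ` vars (App f args)" if s: "s \<in> ?S" for s
  proof -
    obtain x where "s = Var x" using s assms(2) by auto
    then show ?thesis using s W(2) unlabeled by (auto simp: reach_tm_graph)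
  qed
  have "card ({v\<in>e ` ?N. lab K v = None} \<union> (\<Union>v\<in>e ` ?S. reach K v)) \<le> card (e ` Var ` vars (App f args))"
    using nrm safe by (intro card_mono finite_imageI finite_vars) blast
  also have "\<dots> \<le> card (vars (App f args))"
    unfolding image_image by (intro card_image_le finite_vars)
  finally show ?thesis
    unfolding nrm_tm_graph[OF L] safe_tm_graph[OF L] set_map .
qed

lemma inf_rule_conds_tm_graph:
  assumes L: "App f args \<in> W" and R: "App h ts \<in> W"
    and safe: "set (drop (snn S f) args) \<subseteq> range Var"
    and ground: "\<And>s. s \<in> set (take (snn S f) args) \<Longrightarrow> s \<notin> range Var \<Longrightarrow> vars s = {}"
    and num_vars: "card (vars (App f args)) \<le> d"
    and size: "card (subterms (App h ts))
      \<le> card (subterms (App f args)) + card (\<Union> (subterms ` set (take (snn S h) ts)))"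
  shows "inf_rule_conds S d \<lparr>rg = K, lhs = e (App f args), rhs = e (App h ts)\<rparr>"
proof -
  have "closed (restr K v)" if v: "v \<in> set (nrm S K (e (App f args)))" "lab K v \<noteq> None" for v
  proof -
    obtain s where s: "s \<in> set (take (snn S f) args)" "v = e s"
      using v(1) L by (auto simp: nrm_tm_graph)
    then have "s \<in> W" using L by (auto dest: in_set_takeD args_closed)
    moreover have "vars s = {}"
      using s v(2) \<open>s \<in> W\<close> by (intro ground) auto
    ultimately show ?thesis unfolding s(2) by (rule closed_restr_tm_graph)
  qed
  moreover have "set (take (snn S h) ts) \<subseteq> W"
    using args_closed[OF R] by (auto dest: in_set_takeD)
  then have "gsize (restr K (e (App h ts))) \<le> gsize (restr K (e (App f args)))
      + card (\<Union>v\<in>set (nrm S K (e (App h ts))). reach K v)"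
    using size L R
    by (simp add: gsize_restr_tm_graph nrm_tm_graph card_reach_tm_graph_Union del: subterms.simps)
  ultimately show ?thesis
    using max_shared_cap_nrm_restr_tm_graph[OF L safe] card_unlabeled_or_safe_args_le[OF L safe] num_vars
    by (simp add: inf_rule_conds_def)
qed

end

abbreviation rule_terms :: "'c sym tm \<Rightarrow> 'c sym tm \<Rightarrow> 'c sym tm set" where
  "rule_terms L R \<equiv> subterms L \<union> subterms R"

abbreviation rule_code :: "'c sym tm \<Rightarrow> 'c sym tm \<Rightarrow> 'c sym tm \<Rightarrow> nat" where
  "rule_code L R \<equiv> to_nat_on (rule_terms L R)"

definition tm_rule :: "'c sym tm \<Rightarrow> 'c sym tm \<Rightarrow> 'c sym rule" where
  "tm_rule L R = \<lparr> rg = tm_graph (rule_code L R) (rule_terms L R),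
     lhs = rule_code L R L, rhs = rule_code L R R \<rparr>"

lemma tm_rule_sel [simp]:
  "rg (tm_rule L R) = tm_graph (rule_code L R) (rule_terms L R)"
  "lhs (tm_rule L R) = rule_code L R L" "rhs (tm_rule L R) = rule_code L R R"
  by (simp_all add: tm_rule_def)

interpretation rule: tm_coding "rule_code L R" "rule_terms L R" for L R :: "'c sym tm"
  by unfold_locales (auto dest: subterms_subset simp: inj_on_to_nat_on countable_finite)

lemma rule_ok_tm_rule:
  assumes "tm_ok S L" and "tm_ok S R" and "L \<noteq> R" and "vars R \<subseteq> vars L"
  shows "rule_ok S (tm_rule L R)"
proof -
  have "lgraph_ok S (rg (tm_rule L R))"
    using assms(1,2) by (auto intro!: rule.lgraph_ok_tm_graph dest: tm_ok_subterm)
  moreover have "lhs (tm_rule L R) \<noteq> rhs (tm_rule L R)"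
    using assms(3) by (simp add: rule.code_eq_iff)
  moreover have "t \<in> subterms L" if "t \<in> subterms R" "tm_lab t = None" for t
    using that assms(4) by (cases t) (auto simp: in_vars_iff subset_iff)
  ultimately show ?thesis
    by (auto simp: rule_ok_def rule.reach_tm_graph)
qed

lemma lhsG_tm_rule: "lhsG (tm_rule L R) = restr (rg (tm_rule L R)) (rule_code L R L)"
  and rhsG_tm_rule: "rhsG (tm_rule L R) = restr (rg (tm_rule L R)) (rule_code L R R)"
  by (simp_all add: lhsG_def rhsG_def)

section \<open>Matching and rewriting\<close>

fun tm_match :: "'f lgraph \<Rightarrow> ('f tm \<Rightarrow> nat) \<Rightarrow> 'f tm \<Rightarrow> bool" where
  "tm_match g \<mu> (Var x) = (\<mu> (Var x) \<in> nodes g)"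
| "tm_match g \<mu> (App a ts) = (\<mu> (App a ts) \<in> nodes g \<and> lab g (\<mu> (App a ts)) = Some a
     \<and> att g (\<mu> (App a ts)) = map \<mu> ts \<and> (\<forall>t\<in>set ts. tm_match g \<mu> t))"

definition build :: "'f lgraph \<Rightarrow> ('f tm \<Rightarrow> nat) \<Rightarrow> 'f tm \<Rightarrow> 'f tm \<Rightarrow> 'f lgraph" where
  "build g \<mu> L R = (let new = subterms R - subterms L in
     \<lparr> nodes = nodes g \<union> \<mu> ` new,
       lab = (\<lambda>n. if n \<in> nodes g then lab g n
                  else if n \<in> \<mu> ` new then tm_lab (inv_into new \<mu> n) else None),
       att = (\<lambda>n. map (id(\<mu> L := \<mu> R))
               (if n \<in> nodes g then att g n
                else if n \<in> \<mu> ` new then map \<mu> (tm_att (inv_into new \<mu> n)) else [])) \<rparr>)"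

lemma tm_match_iff:
  "tm_match g \<mu> t \<longleftrightarrow> (\<forall>s\<in>subterms t. \<mu> s \<in> nodes g \<and>
     (tm_lab s \<noteq> None \<longrightarrow> lab g (\<mu> s) = tm_lab s \<and> att g (\<mu> s) = map \<mu> (tm_att s)))"
  by (induction t) auto

lemma tm_match_subterm: "tm_match g \<mu> t \<Longrightarrow> s \<in> subterms t \<Longrightarrow> tm_match g \<mu> s"
  by (induction t) auto

lemma tm_match_cong: "(\<And>s. s \<in> subterms t \<Longrightarrow> \<mu> s = \<nu> s) \<Longrightarrow> tm_match g \<mu> t \<longleftrightarrow> tm_match g \<nu> t"
proof (induction t)
  case (App a ts)
  have "\<mu> t = \<nu> t" if "t \<in> set ts" for t using App.prems[OF arg_in_subterms[OF that]] .
  then have "map \<mu> ts = map \<nu> ts" by simp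
  then show ?case using App by auto
qed simp

lemma match_subterm_below:
  assumes "tm_match g \<mu> t" and "s \<in> subterms t" and "s \<noteq> t"
  shows "(\<mu> t, \<mu> s) \<in> (edges g)\<^sup>+"
  using assms
proof (induction t)
  case (App a ts)
  then obtain u where u: "u \<in> set ts" "s \<in> subterms u" by auto
  then have "(\<mu> (App a ts), \<mu> u) \<in> edges g" using App.prems(1) by (auto simp: edges_def)
  then show ?case
    using App.IH[OF u(1) _ u(2)] App.prems(1) u(1) by (cases "s = u") auto
qed simp

lemma match_subterm_reach: "tm_match g \<mu> t \<Longrightarrow> s \<in> subterms t \<Longrightarrow> \<mu> s \<in> reach g (\<mu> t)"
  using match_subterm_below[of g \<mu> t s]
  by (cases "s = t") (auto simp: reach_def trancl_into_rtrancl)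

lemma tm_match_append_vars:
  assumes v: "v \<in> nodes g" "lab g v = Some a" "att g v = map \<nu> ps @ us" "set us \<subseteq> nodes g"
    and ps: "\<And>p. p \<in> set ps \<Longrightarrow> tm_match g \<nu> p" "\<And>p. p \<in> set ps \<Longrightarrow> vars p \<subseteq> {..<n}"
  shows "\<exists>\<mu>. tm_match g \<mu> (App a (ps @ map Var [n..<n + length us]))
    \<and> \<mu> (App a (ps @ map Var [n..<n + length us])) = v"
proof -
  let ?L = "App a (ps @ map Var [n..<n + length us])"
  define \<mu> where "\<mu> t = (case t of Var j \<Rightarrow> if n \<le> j then us ! (j - n) else \<nu> t
    | App _ _ \<Rightarrow> if t = ?L then v else \<nu> t)" for t
  have "\<mu> s = \<nu> s" if p: "p \<in> set ps" and s: "s \<in> subterms p" for p s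
  proof -
    have "s \<noteq> ?L"
    proof
      assume "s = ?L"
      then have "p \<in> subterms s" using p by (auto simp del: subterms.simps intro: arg_in_subterms)
      then have "size p \<le> size s" "size s \<le> size p" using s by (auto dest: size_subterm)
      moreover have "size p < size s" using p size_tm_att[of p ?L] \<open>s = ?L\<close> by simp
      ultimately show False by simp
    qed
    moreover have "j < n" if "s = Var j" for j
      using that s ps(2)[OF p] by (auto simp: in_vars_iff)
    ultimately show ?thesis by (auto simp: \<mu>_def split: tm.split)
  qed
  then have "tm_match g \<mu> p" "\<mu> p = \<nu> p" if "p \<in> set ps" for p
    using that ps(1) tm_match_cong[of p \<mu> \<nu> g] by auto
  moreover have "map \<mu> (map Var [n..<n + length us]) = us"
    by (intro nth_equalityI) (auto simp: \<mu>_def)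
  moreover have "\<mu> (Var j) \<in> nodes g" if "j \<in> {n..<n + length us}" for j
    using v(4) that by (auto simp: \<mu>_def subset_iff)
  moreover have "\<mu> ?L = v" by (simp add: \<mu>_def)
  ultimately have "tm_match g \<mu> ?L \<and> \<mu> ?L = v" using v by (auto simp del: map_map)
  then show ?thesis by (rule exI[of _ \<mu>])
qed

lemma hom_lhsG_tm_rule:
  "hom (lhsG (tm_rule L R)) g \<psi> \<longleftrightarrow> tm_match g (\<psi> \<circ> rule_code L R) L"
  by (auto simp: hom_def tm_match_iff lhsG_tm_rule rule.reach_tm_graph)

lemma new_nodes_tm_rule:
  "reach (rg (tm_rule L R)) (rhs (tm_rule L R)) - reach (rg (tm_rule L R)) (lhs (tm_rule L R))
    = rule_code L R ` (subterms R - subterms L)"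
  using inj_on_image_set_diff[OF rule.inj_code[of L R], of "subterms R" "subterms L"]
  by (auto simp: rule.reach_tm_graph)

lemma step_result_tm_rule:
  fixes L R
  defines "e \<equiv> rule_code L R" and "new \<equiv> subterms R - subterms L"
  assumes inj: "inj_on \<psi> (e ` new)"
  shows "step_result (tm_rule L R) G \<psi>
    = restr (build (gr G) (\<psi> \<circ> e) L R) ((id(\<psi> (e L) := \<psi> (e R))) (root G))"
proof -
  have "inj_on e new"
    using rule.inj_code[of L R] unfolding e_def new_def by (rule inj_on_subset) blast
  then have inv: "the_inv_into (e ` new) \<psi> (\<psi> (e t)) = e t" "inv_into new (\<psi> \<circ> e) (\<psi> (e t)) = t"
    if "t \<in> new" for t
    using that inj comp_inj_on[of e new \<psi>] inv_into_f_f[of "\<psi> \<circ> e" new t]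
    by (auto simp: the_inv_into_f_f)
  have K: "lab (rg (tm_rule L R)) (e t) = tm_lab t" "att (rg (tm_rule L R)) (e t) = map e (tm_att t)"
    if "t \<in> new" for t
    using that by (simp_all add: e_def new_def)
  have red: "(\<lambda>n. if n = \<psi> (e L) then \<psi> (e R) else n) = id(\<psi> (e L) := \<psi> (e R))"
    by auto
  have new_nodes: "reach (rg (tm_rule L R)) (rhs (tm_rule L R)) - reach (rg (tm_rule L R)) (lhs (tm_rule L R))
      = e ` new"
    unfolding new_nodes_tm_rule e_def new_def ..
  have sel: "lhs (tm_rule L R) = e L" "rhs (tm_rule L R) = e R"
    by (simp_all add: e_def)
  show ?thesis
    unfolding step_result_def Let_def new_nodes
    unfolding sel red build_def Let_def comp_apply new_def[symmetric]
    by (intro arg_cong2[where f = restr] lgraph.equality refl)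
      (auto simp: inv[unfolded comp_def] K image_comp comp_def fun_eq_iff simp del: tm_rule_sel)
qed

lemma rstep_tm_rules_cases:
  assumes "rstep (case_prod tm_rule ` E) G H"
  obtains L R \<mu> where "(L, R) \<in> E" "tm_match (gr G) \<mu> L" "inj_on \<mu> (subterms R - subterms L)"
    "\<mu> ` (subterms R - subterms L) \<inter> nodes (gr G) = {}"
    "H = restr (build (gr G) \<mu> L R) ((id(\<mu> L := \<mu> R)) (root G))"
proof -
  obtain L R \<psi> where "(L, R) \<in> E" and hom: "hom (lhsG (tm_rule L R)) (gr G) \<psi>"
    and inj: "inj_on \<psi> (rule_code L R ` (subterms R - subterms L))"
    and disj: "\<psi> ` rule_code L R ` (subterms R - subterms L) \<inter> nodes (gr G) = {}"
    and H: "H = step_result (tm_rule L R) G \<psi>"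
    using assms unfolding rstep_def by (auto simp only: new_nodes_tm_rule)
  have "inj_on (rule_code L R) (subterms R - subterms L)"
    using rule.inj_code[of L R] by (rule inj_on_subset) blast
  then show ?thesis
    using that[of L R "\<psi> \<circ> rule_code L R"] \<open>(L, R) \<in> E\<close> hom inj disj
    unfolding H step_result_tm_rule[OF inj] hom_lhsG_tm_rule by (simp add: comp_inj_on image_comp)
qed

lemma rstep_tm_rules_if_match:
  assumes "(L, R) \<in> E" and match: "tm_match (gr G) \<mu> L" and fin: "finite (nodes (gr G))"
  shows "\<exists>H. rstep (case_prod tm_rule ` E) G H"
proof -
  let ?e = "rule_code L R"
  define \<psi> where "\<psi> n = (if n \<in> ?e ` subterms L then \<mu> (inv_into (subterms L) ?e n)
    else n + Suc (Max (nodes (gr G))))" for n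
  have "inj_on ?e (subterms L)"
    using rule.inj_code[of L R] by (rule inj_on_subset) blast
  then have "tm_match (gr G) (\<psi> \<circ> ?e) L"
    using match tm_match_cong[of L "\<psi> \<circ> ?e" \<mu>] by (simp add: \<psi>_def)
  moreover have new: "\<psi> (?e t) = ?e t + Suc (Max (nodes (gr G)))"
    if "t \<in> subterms R - subterms L" for t
    using that rule.code_eq_iff[of t L R] by (auto simp: \<psi>_def)
  have "inj_on \<psi> (?e ` (subterms R - subterms L))"
    by (rule inj_onI) (auto simp: new)
  moreover have "n + Suc (Max (nodes (gr G))) \<notin> nodes (gr G)" for n
    using Max_ge[OF fin, of "n + Suc (Max (nodes (gr G)))"] by auto
  then have "\<psi> ` ?e ` (subterms R - subterms L) \<inter> nodes (gr G) = {}"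
    by (auto simp: new)
  ultimately show ?thesis
    using assms(1) unfolding rstep_def
    by (intro exI bexI[of _ "tm_rule L R"] conjI refl)
      (auto simp only: new_nodes_tm_rule hom_lhsG_tm_rule intro!: image_eqI[of _ _ "(L, R)"])
qed

section \<open>Invariants of rewriting\<close>

definition valuation :: "('f \<Rightarrow> 'a list \<Rightarrow> 'a) \<Rightarrow> 'f lgraph \<Rightarrow> (nat \<Rightarrow> 'a) \<Rightarrow> bool" where
  "valuation I g val \<longleftrightarrow>
     (\<forall>v\<in>nodes g. \<forall>a. lab g v = Some a \<longrightarrow> val v = I a (map val (att g v)))"

text \<open>Rewriting never touches the nodes in \<open>N\<close>, so along a computation they are nodes of the initial graph.\<close>

definition normal_part :: "'c sig \<Rightarrow> nat set \<Rightarrow> 'c sym lgraph \<Rightarrow> bool" where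
  "normal_part S N g \<longleftrightarrow> N \<subseteq> nodes g
     \<and> (\<forall>v\<in>N. set (att g v) \<subseteq> N \<and> lab g v \<in> Some ` range Con)
     \<and> (\<forall>v\<in>nodes g. set (nrm S g v) \<subseteq> N)"

text \<open>An unlabeled node contributes the junk value \<open>the None\<close>; the graphs of a computation are closed.\<close>

definition label_mset :: "'f lgraph \<Rightarrow> 'f multiset" where
  "label_mset g = image_mset (\<lambda>v. the (lab g v)) (mset_set (nodes g))"

lemma nrm_subset_att: "set (nrm S g v) \<subseteq> set (att g v)"
  by (auto simp: nrm_def dest: in_set_takeD split: option.splits)

lemma valuation_exists:
  assumes ok: "lgraph_ok S g"
  obtains val where "valuation I g val" and "\<And>v t. repr g v t \<Longrightarrow> val v = eval I \<sigma> t"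
proof
  define val where "val v = eval I \<sigma> (THE t. repr g v t)" for v
  show val: "val v = eval I \<sigma> t" if "repr g v t" for v t
  proof -
    have "(THE t. repr g v t) = t"
      using that repr_functional by (intro the_equality) blast+
    then show ?thesis by (simp add: val_def)
  qed
  show "valuation I g val"
    unfolding valuation_def
  proof (intro ballI allI impI)
    fix v a assume v: "v \<in> nodes g" "lab g v = Some a"
    obtain t where t: "repr g v t" using repr_total[OF ok v(1)] by blast
    then obtain ts where ts: "t = App a ts" "list_all2 (repr g) (att g v) ts"
      using v by cases auto
    then have "map val (att g v) = map (eval I \<sigma>) ts"
      using val by (auto simp: list_all2_conv_all_nth intro!: nth_equalityI)
    then show "val v = I a (map val (att g v))"
      using val[OF t] ts(1) by simp
  qed
qed

lemma valuation_match:
  assumes "valuation I g val"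
  shows "tm_match g \<mu> t \<Longrightarrow> val (\<mu> t) = eval I (\<lambda>x. val (\<mu> (Var x))) t"
proof (induction t)
  case (App a ts)
  then have "val (\<mu> (App a ts)) = I a (map val (map \<mu> ts))"
    using assms by (simp add: valuation_def)
  also have "map val (map \<mu> ts) = map (eval I (\<lambda>x. val (\<mu> (Var x)))) ts"
    using App by auto
  finally show ?case by simp
qed simp

lemma valuation_restr: "valuation I g val \<Longrightarrow> reach g v \<subseteq> nodes g \<Longrightarrow> valuation I (gr (restr g v)) val"
  by (auto simp: valuation_def)

lemma normal_part_reach:
  assumes "normal_part S N g" and "v \<in> N"
  shows "reach g v \<subseteq> N"
  using assms by (intro reach_subset) (auto simp: normal_part_def)

lemma normal_part_restr:
  assumes "normal_part S N g" and "reach g v \<subseteq> nodes g"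
  shows "normal_part S (N \<inter> reach g v) (gr (restr g v))"
proof -
  have att: "set (att g u) \<subseteq> reach g v" if "u \<in> reach g v" for u
    using that assms(2) reach_successor by blast
  have "set (nrm S (gr (restr g v)) u) \<subseteq> N \<inter> reach g v" if u: "u \<in> reach g v" for u
  proof -
    have "nrm S (gr (restr g v)) u = nrm S g u" using u by (simp add: nrm_def split: option.split)
    moreover have "set (nrm S g u) \<subseteq> N"
      using assms u by (auto simp: normal_part_def)
    ultimately show ?thesis using att[OF u] nrm_subset_att[of S g u] by auto
  qed
  then show ?thesis
    using assms(1) att unfolding normal_part_def by auto
qed

lemma normal_part_basic:
  assumes G: "tgraph_ok S G" "closed G" "basic S G"
  shows "normal_part S (nodes (gr G) - {root G}) (gr G)"
proof -
  let ?g = "gr G" and ?\<rho> = "root G"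
  have ok: "lgraph_ok S ?g" and reach: "nodes ?g = reach ?g ?\<rho>"
    using G(1) by (simp_all add: tgraph_ok_def)
  have "?\<rho> \<notin> set (att ?g v)" if v: "v \<in> nodes ?g" for v
  proof
    assume "?\<rho> \<in> set (att ?g v)"
    then have "(v, ?\<rho>) \<in> edges ?g" using v by (simp add: edges_def)
    moreover have "(?\<rho>, v) \<in> (edges ?g)\<^sup>*" using v reach by (simp add: reach_def)
    ultimately show False
      using ok by (auto simp: lgraph_ok_def acyclic_def dest: rtrancl_into_trancl1)
  qed
  then have att: "set (att ?g v) \<subseteq> nodes ?g - {?\<rho>}" if "v \<in> nodes ?g" for v
    using that lgraph_okD(1)[OF ok that] by auto
  have con: "lab ?g v \<in> Some ` range Con" if v: "v \<in> nodes ?g - {?\<rho>}" for v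
  proof -
    have "(?\<rho>, v) \<in> (edges ?g)\<^sup>*" using v reach by (simp add: reach_def)
    then obtain u where "(?\<rho>, u) \<in> edges ?g" "(u, v) \<in> (edges ?g)\<^sup>*"
      using v by (cases rule: converse_rtranclE) auto
    then have u: "u \<in> set (att ?g ?\<rho>)" "v \<in> reach ?g u"
      by (simp_all add: edges_def reach_def)
    then have "over_C S (sub G u)" using G(3) by (simp add: basic_def)
    moreover obtain a where "lab ?g v = Some a" using v G(2) by (auto simp: closed_def)
    ultimately have "a \<in> Con ` set (cons S)" using u(2) by (simp add: over_C_def sub_def)
    then show ?thesis using \<open>lab ?g v = Some a\<close> by blast
  qed
  show ?thesis
    using att con nrm_subset_att unfolding normal_part_def by (meson DiffD1 Diff_subset order_trans)
qed

lemma mult_image_mset_set: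
  assumes "finite V" and "finite B" and sub: "U \<subseteq> V - {w} \<union> B" and "w \<in> V"
    and same: "\<And>v. v \<in> U \<inter> V \<Longrightarrow> f v = h v" and less: "\<And>v. v \<in> U \<inter> B \<Longrightarrow> (f v, h w) \<in> r"
  shows "(image_mset f (mset_set U), image_mset h (mset_set V)) \<in> mult r"
proof -
  define C where "C = U \<inter> (V - {w})"
  have fin: "finite C" "finite (U - C)" "finite (V - C)"
    using assms(1,2) finite_subset[OF sub] by (simp_all add: C_def)
  have sub_C: "C \<subseteq> U" "C \<subseteq> V" by (auto simp: C_def)
  have split: "mset_set A = mset_set C + mset_set (A - C)" if "C \<subseteq> A" "finite (A - C)" for A
    using that fin(1) mset_set_Union[of C "A - C"] Diff_partition[of C A] by simp
  have "image_mset f (mset_set C) = image_mset h (mset_set C)"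
    using fin(1) same by (intro image_mset_cong) (auto simp: C_def)
  then have U: "image_mset f (mset_set U) = image_mset h (mset_set C) + image_mset f (mset_set (U - C))"
    using split[OF sub_C(1) fin(2)] by simp
  have V: "image_mset h (mset_set V) = image_mset h (mset_set C) + image_mset h (mset_set (V - C))"
    using split[OF sub_C(2) fin(3)] by simp
  have "w \<in> V - C" "U - C \<subseteq> U \<inter> B" using assms(4) sub by (auto simp: C_def)
  then show ?thesis
    unfolding U V using fin less by (intro one_step_implies_mult) (auto simp: mset_set_empty_iff)
qed

locale tm_step =
  fixes S :: "'c sig" and g :: "'c sym lgraph" and \<mu> :: "'c sym tm \<Rightarrow> nat" and L R :: "'c sym tm"
  assumes graph_ok: "lgraph_ok S g"
    and match: "tm_match g \<mu> L"
    and inj_new: "inj_on \<mu> (subterms R - subterms L)"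
    and fresh: "\<mu> ` (subterms R - subterms L) \<inter> nodes g = {}"
    and tm_ok_rhs: "tm_ok S R"
    and vars_rhs: "vars R \<subseteq> vars L"
    and lhs_notin_rhs: "L \<notin> subterms R"
begin

abbreviation new :: "'c sym tm set" where
  "new \<equiv> subterms R - subterms L"

abbreviation red :: "nat \<Rightarrow> nat" where
  "red \<equiv> id(\<mu> L := \<mu> R)"

abbreviation g' :: "'c sym lgraph" where
  "g' \<equiv> build g \<mu> L R"

lemma matched: "t \<in> subterms L \<Longrightarrow> \<mu> t \<in> nodes g"
  using match by (simp add: tm_match_iff)

lemma new_fresh: "t \<in> new \<Longrightarrow> \<mu> t \<notin> nodes g"
  using fresh by auto

lemma nodes_build: "nodes g' = nodes g \<union> \<mu> ` new"
  and lab_build_old: "v \<in> nodes g \<Longrightarrow> lab g' v = lab g v"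
  and att_build_old: "v \<in> nodes g \<Longrightarrow> att g' v = map red (att g v)"
  by (simp_all add: build_def Let_def)

lemma below_lhs: "t \<in> subterms L \<Longrightarrow> t \<noteq> L \<Longrightarrow> (\<mu> L, \<mu> t) \<in> (edges g)\<^sup>+"
  using match by (rule match_subterm_below)

lemma match_neq_lhs:
  assumes "t \<in> subterms L \<union> new" and "t \<noteq> L"
  shows "\<mu> t \<noteq> \<mu> L"
proof (cases "t \<in> new")
  case True
  then show ?thesis using new_fresh matched[OF subterms_refl] by metis
next
  case False
  then have "(\<mu> L, \<mu> t) \<in> (edges g)\<^sup>+" using assms below_lhs by blast
  then show ?thesis using graph_ok by (auto simp: lgraph_ok_def acyclic_def)
qed

lemma rhs_neq_lhs: "\<mu> R \<noteq> \<mu> L"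
  using lhs_notin_rhs by (intro match_neq_lhs) auto

lemma tm_att_new:
  assumes "t \<in> new" and "s \<in> set (tm_att t)"
  shows "s \<in> subterms L \<union> new" and "s \<noteq> L"
proof -
  have "s \<in> subterms R" using assms tm_att_subset_subterms[of t] subterms_subset[of t R] by blast
  then show "s \<in> subterms L \<union> new" and "s \<noteq> L" using lhs_notin_rhs by auto
qed

lemma lab_build_new: "t \<in> new \<Longrightarrow> lab g' (\<mu> t) = tm_lab t"
  using new_fresh inj_new by (simp add: build_def Let_def)

lemma nodes_build_cases:
  assumes "v \<in> nodes g'"
  obtains (old) "v \<in> nodes g" | (new) a ts where "App a ts \<in> new" "v = \<mu> (App a ts)"
proof (cases "v \<in> nodes g")
  case False
  then obtain t where "t \<in> new" "v = \<mu> t" using assms by (auto simp: nodes_build)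
  moreover from this obtain a ts where "t = App a ts"
    using vars_rhs by (cases t) (auto simp: in_vars_iff)
  ultimately show ?thesis using new by blast
qed (rule old)

lemma att_build_new:
  assumes "t \<in> new"
  shows "att g' (\<mu> t) = map \<mu> (tm_att t)"
proof -
  have "att g' (\<mu> t) = map red (map \<mu> (tm_att t))"
    using assms new_fresh inj_new by (simp add: build_def Let_def)
  moreover have "red (\<mu> s) = \<mu> s" if "s \<in> set (tm_att t)" for s
    using match_neq_lhs[OF tm_att_new[OF assms that]] by simp
  ultimately show ?thesis by simp
qed

lemma tm_lab_new: "t \<in> new \<Longrightarrow> tm_lab t \<noteq> None"
  using vars_rhs by (auto simp: tm_lab_eq_None_iff in_vars_iff subset_iff)

lemma edges_build_cases:
  assumes "(v, u) \<in> edges g'"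
  obtains (old) w where "(v, w) \<in> edges g" "u = red w"
    | (new) t s where "t \<in> new" "v = \<mu> t" "s \<in> set (tm_att t)" "u = \<mu> s"
proof (cases "v \<in> nodes g")
  case True
  then show ?thesis using assms old by (auto simp: edges_def att_build_old simp del: fun_upd_apply)
next
  case False
  then show ?thesis using assms new by (auto simp: edges_def nodes_build att_build_new)
qed

text \<open>New nodes are placed directly below the redex and ordered among themselves by term size.\<close>

lemma acyclic_build: "acyclic (edges g')"
proof -
  define f where "f n = (if n \<in> nodes g then (n, 0) else (\<mu> L, size (inv_into new \<mu> n)))" for n
  define r where "r = ((edges g)\<^sup>+)\<inverse> <*lex*> less_than"
  have f_old: "f v = (v, 0)" if "v \<in> nodes g" for v
    using that by (simp add: f_def)
  have f_new: "f (\<mu> t) = (\<mu> L, size t)" if "t \<in> new" for t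
    using that new_fresh inj_new by (simp add: f_def)
  have below: "(f (\<mu> t), (\<mu> L, n)) \<in> r" if "t \<in> subterms L \<union> new" "t \<noteq> L" "size t < n" for t n
    using that below_lhs f_old[OF matched, of t] f_new[of t]
    by (cases "t \<in> subterms L") (auto simp: r_def)
  have "(f u, f v) \<in> r" if "(v, u) \<in> edges g'" for u v
    using that
  proof (cases rule: edges_build_cases)
    case (old w)
    then have "v \<in> nodes g" "w \<in> nodes g"
      using lgraph_okD(1)[OF graph_ok] by (auto simp: edges_def)
    moreover have "R \<in> new \<or> (\<mu> L, \<mu> R) \<in> (edges g)\<^sup>+ \<and> \<mu> R \<in> nodes g"
      using below_lhs matched lhs_notin_rhs by auto
    ultimately show ?thesis
      using old f_new[of R] by (auto simp: f_old r_def intro: trancl_into_trancl2)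
  next
    case (new t s)
    then show ?thesis
      using below tm_att_new[OF new(1,3)] size_tm_att[OF new(3)] f_new by auto
  qed
  then have "(edges g')\<inverse> \<subseteq> inv_image r f" by auto
  moreover have "wf r"
    using wf_edges_converse[OF graph_ok]
    by (auto simp: r_def trancl_converse[symmetric] intro: wf_trancl)
  ultimately have "acyclic ((edges g')\<inverse>)"
    by (meson wf_acyclic wf_inv_image wf_subset)
  then show ?thesis by simp
qed

lemma red_in_build:
  assumes "v \<in> nodes g"
  shows "red v \<in> nodes g - {\<mu> L} \<union> \<mu> ` new"
  using assms rhs_neq_lhs matched[of R] by auto

lemma att_build_subset:
  assumes "v \<in> nodes g'"
  shows "set (att g' v) \<subseteq> nodes g - {\<mu> L} \<union> \<mu> ` new"
  using assms
proof (cases rule: nodes_build_cases)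
  case old
  then show ?thesis
    using lgraph_okD(1)[OF graph_ok old] red_in_build by (auto simp only: att_build_old set_map)
next
  case (new a ts)
  have "\<mu> s \<in> nodes g - {\<mu> L} \<union> \<mu> ` new" if "s \<in> set ts" for s
    using tm_att_new[OF new(1), of s] that match_neq_lhs[of s] matched[of s] by auto
  then show ?thesis unfolding new(2) att_build_new[OF new(1)] by auto
qed

lemma reach_build: "v \<in> nodes g \<Longrightarrow> reach g' (red v) \<subseteq> nodes g - {\<mu> L} \<union> \<mu> ` new"
  using red_in_build att_build_subset by (intro reach_subset)

lemma lgraph_ok_build: "lgraph_ok S g'"
proof -
  have "length (att g' v) = (case lab g' v of None \<Rightarrow> 0 | Some a \<Rightarrow> sar S a)
      \<and> (\<forall>a. lab g' v = Some a \<longrightarrow> a \<in> Fsyms S)" if "v \<in> nodes g'" for v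
    using that
  proof (cases rule: nodes_build_cases)
    case old
    then show ?thesis using graph_ok by (simp add: lgraph_ok_def lab_build_old att_build_old)
  next
    case (new a ts)
    then have "tm_ok S (App a ts)" using tm_ok_rhs tm_ok_subterm by blast
    then show ?thesis unfolding new(2) using new(1) by (simp add: lab_build_new att_build_new)
  qed
  moreover have "finite (nodes g')" using graph_ok by (simp add: lgraph_ok_def nodes_build)
  moreover have "lab g' v = None \<and> att g' v = []" if "v \<notin> nodes g'" for v
    using that by (auto simp: build_def Let_def)
  moreover have "set (att g' v) \<subseteq> nodes g'" if "v \<in> nodes g'" for v
    using att_build_subset[OF that] by (auto simp: nodes_build)
  ultimately show ?thesis
    using acyclic_build unfolding lgraph_ok_def by blast
qed

lemma labeled_build:
  assumes "\<And>v. v \<in> nodes g \<Longrightarrow> lab g v \<noteq> None" and "v \<in> nodes g'"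
  shows "lab g' v \<noteq> None"
  using assms tm_lab_new by (auto simp: nodes_build lab_build_old lab_build_new)

lemma valuation_build:
  assumes val: "valuation I g val"
    and sound: "eval I (\<lambda>x. val (\<mu> (Var x))) L = eval I (\<lambda>x. val (\<mu> (Var x))) R"
  obtains val' where "valuation I g' val'" and "\<And>v. v \<in> nodes g \<Longrightarrow> val' v = val v"
    and "\<And>v. v \<in> nodes g \<Longrightarrow> val' (red v) = val v"
proof
  define \<sigma> where "\<sigma> = (\<lambda>x. val (\<mu> (Var x)))"
  define val' where "val' v = (if v \<in> nodes g then val v else eval I \<sigma> (inv_into new \<mu> v))" for v
  show unchanged: "val' v = val v" if "v \<in> nodes g" for v
    using that by (simp add: val'_def)
  have eval: "val' (\<mu> t) = eval I \<sigma> t" if "t \<in> subterms L \<union> new" for t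
    using that matched[of t] new_fresh[of t] inv_into_f_f[OF inj_new, of t]
      valuation_match[OF val tm_match_subterm[OF match], of t]
    by (cases "t \<in> subterms L") (auto simp: val'_def \<sigma>_def)
  have "val' (\<mu> R) = val (\<mu> L)"
    using eval[of R] eval[of L] sound unchanged[OF matched[OF subterms_refl]] by (simp add: \<sigma>_def)
  then show red: "val' (red v) = val v" if "v \<in> nodes g" for v
    using unchanged[OF that] by simp
  show "valuation I g' val'"
    unfolding valuation_def
  proof (intro ballI allI impI)
    fix v a assume v: "v \<in> nodes g'" and a: "lab g' v = Some a"
    from v show "val' v = I a (map val' (att g' v))"
    proof (cases rule: nodes_build_cases)
      case old
      have "map val' (att g' v) = map val (att g v)"
        using lgraph_okD(1)[OF graph_ok old] red
        by (auto simp: att_build_old[OF old] simp del: fun_upd_apply)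
      then show ?thesis
        using val old a by (simp add: valuation_def unchanged lab_build_old)
    next
      case (new b ts)
      have "map val' (att g' v) = map (eval I \<sigma>) ts"
        using new eval tm_att_new[OF new(1)] by (auto simp: att_build_new)
      moreover have "b = a" using a new by (simp add: lab_build_new)
      ultimately show ?thesis
        using new eval[of "App b ts"] by simp
    qed
  qed
qed

lemma new_normal_args:
  assumes N: "normal_part S N g" and L: "L = App (Fn f) args"
    and pt: "tm_pt S (snn S (Fn f)) args R"
    and t: "App a ts \<in> new" "u \<in> set (take (snn S a) ts)"
  shows "\<mu> u \<in> N"
proof -
  have "App a ts \<notin> subterms s" if "s \<in> set args" for s
    using that t(1) subterms_subset[OF arg_in_subterms[OF that, of "Fn f"]] L by auto
  then obtain s where s: "s \<in> set (take (snn S (Fn f)) args)" "u \<in> subterms s"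
    using tm_pt_normal_args[OF pt _ _ t(2)] t(1) by auto
  have root: "lab g (\<mu> L) = Some (Fn f)" "att g (\<mu> L) = map \<mu> args" "\<mu> L \<in> nodes g"
    using match L by auto
  then have "\<mu> s \<in> set (nrm S g (\<mu> L))"
    using s(1) by (simp add: nrm_def take_map del: snn.simps)
  then have "\<mu> s \<in> N" using N root(3) by (auto simp: normal_part_def)
  moreover have "tm_match g \<mu> s"
    using match s(1) L by (auto dest: in_set_takeD)
  ultimately show ?thesis using match_subterm_reach[OF _ s(2)] normal_part_reach[OF N] by blast
qed

lemma normal_part_build:
  assumes N: "normal_part S N g" and L: "L = App (Fn f) args"
    and pt: "tm_pt S (snn S (Fn f)) args R"
  shows "normal_part S N g'"
proof -
  have "lab g (\<mu> L) = Some (Fn f)" using match L by auto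
  then have "\<mu> L \<notin> N" using N by (auto simp: normal_part_def)
  then have red: "map red vs = vs" if "set vs \<subseteq> N" for vs
    using that by (intro map_idI) auto
  have Ng: "N \<subseteq> nodes g" using N by (simp add: normal_part_def)
  have "set (nrm S g' v) \<subseteq> N" if "v \<in> nodes g'" for v
    using that
  proof (cases rule: nodes_build_cases)
    case old
    then have "nrm S g' v = map red (nrm S g v)"
      by (simp add: nrm_def lab_build_old att_build_old take_map split: option.split)
    moreover have "set (nrm S g v) \<subseteq> N" using N old by (simp add: normal_part_def)
    ultimately show ?thesis using red by simp
  next
    case (new a ts)
    then have "nrm S g' v = map \<mu> (take (snn S a) ts)"
      by (simp add: nrm_def lab_build_new att_build_new take_map)
    then show ?thesis using new_normal_args[OF N L pt new(1)] by auto
  qed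
  moreover have "set (att g' v) \<subseteq> N \<and> lab g' v \<in> Some ` range Con" if "v \<in> N" for v
    using that N subsetD[OF Ng that] red by (simp add: normal_part_def lab_build_old att_build_old)
  ultimately show ?thesis
    using Ng by (auto simp: normal_part_def nodes_build)
qed

lemma label_mset_build:
  assumes "tm_lab L = Some f" and "set_tm R \<subseteq> {a. (a, f) \<in> P}" and "v \<in> nodes g"
  shows "(label_mset (gr (restr g' (red v))), label_mset g) \<in> mult P"
  unfolding label_mset_def
proof (rule mult_image_mset_set)
  show "finite (nodes g)" using graph_ok by (simp add: lgraph_ok_def)
  show "finite (\<mu> ` new)" by simp
  show "nodes (gr (restr g' (red v))) \<subseteq> nodes g - {\<mu> L} \<union> \<mu> ` new"
    using reach_build[OF assms(3)] by simp
  show "\<mu> L \<in> nodes g" using matched by simp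
  show "the (lab (gr (restr g' (red v))) u) = the (lab g u)"
    if "u \<in> nodes (gr (restr g' (red v))) \<inter> nodes g" for u
    using that by (simp add: lab_build_old)
next
  fix u assume "u \<in> nodes (gr (restr g' (red v))) \<inter> \<mu> ` new"
  then obtain t where t: "t \<in> new" "lab (gr (restr g' (red v))) u = tm_lab t"
    by (auto simp: lab_build_new)
  moreover obtain a where a: "tm_lab t = Some a" using tm_lab_new[OF t(1)] by auto
  moreover have "a \<in> set_tm R" using t(1) a set_tm_if_tm_lab[of t R a] by simp
  moreover have "lab g (\<mu> L) = Some f" using match assms(1) by (cases L) auto
  ultimately show "(the (lab (gr (restr g' (red v))) u), the (lab g (\<mu> L))) \<in> P"
    using assms(2) by auto
qed

end

section \<open>Programs\<close>

text \<open>A program defines the symbol \<open>Fn i\<close> by its \<open>i\<close>-th entry, in terms of earlier symbols.\<close>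

datatype 'c scheme = Explicit "'c sym tm" | Cases "'c \<Rightarrow> 'c sym tm" | Recursion "'c \<Rightarrow> nat"

datatype 'c fundef = Fundef (normals: nat) (safes: nat)
  (meaning: "'c gterm list \<Rightarrow> 'c gterm list \<Rightarrow> 'c gterm") (scheme: "'c scheme")

type_synonym 'c program = "'c fundef list"

fun interp :: "'c program \<Rightarrow> 'c sym \<Rightarrow> 'c gterm list \<Rightarrow> 'c gterm" where
  "interp P (Con c) us = T c us"
| "interp P (Fn i) us = meaning (P ! i) (take (normals (P ! i)) us) (drop (normals (P ! i)) us)"

fun unfolding_tm :: "('c \<Rightarrow> nat) \<Rightarrow> nat \<Rightarrow> 'c gterm \<Rightarrow> 'c sym tm" where
  "unfolding_tm h m (T c ts) = App (Fn (h c)) (map emb ts @ map Var [0..<m] @ map (unfolding_tm h m) ts)"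

fun sym_rank :: "'c sym \<Rightarrow> nat" where
  "sym_rank (Con c) = 0"
| "sym_rank (Fn i) = Suc i"

lemma eval_emb: "eval (interp P) \<sigma> (emb t) = t"
  by (induction t) (auto intro: map_idI)

lemma inj_emb: "inj emb"
  by (metis eval_emb injI)

lemma vars_emb [simp]: "vars (emb t) = {}"
  by (induction t) auto

lemma vars_unfolding_tm: "vars (unfolding_tm h m t) \<subseteq> {..<m}"
  by (induction t) auto

lemma valuation_normal_part:
  assumes "normal_part S N g" and "valuation (interp P) g val" and "v \<in> N"
  obtains c where "lab g v = Some (Con c)" and "val v = T c (map val (att g v))"
  using assms by (fastforce simp: normal_part_def valuation_def)

lemma repr_normal_part:
  assumes N: "normal_part S N g" and val: "valuation (interp P) g val"
  shows "v \<in> N \<Longrightarrow> repr g v (emb (val v))"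
proof (induction "val v" arbitrary: v)
  case (T c ts)
  obtain b where b: "lab g v = Some (Con b)" "val v = T b (map val (att g v))"
    using N val T.prems by (rule valuation_normal_part)
  have "set (att g v) \<subseteq> N" using N T.prems by (simp add: normal_part_def)
  then have "repr g u (emb (val u))" if "u \<in> set (att g v)" for u
    using T.hyps(1)[of u] T.hyps(2) b(2) that by auto
  then have "list_all2 (repr g) (att g v) (map emb (map val (att g v)))"
    by (simp add: list_all2_map2 list_all2_same)
  moreover have "v \<in> nodes g" using N T.prems by (auto simp: normal_part_def)
  ultimately show ?case using b(1) unfolding b(2) emb.simps by (blast intro: rapp)
qed

lemma inv_into_emb_val:
  assumes "inj_on val N" and "v \<in> N"
  shows "inv_into N (emb \<circ> val) (emb (val v)) = v"
proof -
  have "inj_on (emb \<circ> val) N" using assms(1) inj_emb by (blast intro: comp_inj_on inj_on_subset)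
  then show ?thesis using inv_into_f_f[of "emb \<circ> val" N v] assms(2) by simp
qed

lemma match_normal_part:
  assumes N: "normal_part S N g" and val: "valuation (interp P) g val" and inj: "inj_on val N"
  shows "v \<in> N \<Longrightarrow> tm_match g (inv_into N (emb \<circ> val)) (emb (val v))"
proof (induction "val v" arbitrary: v)
  case (T c ts)
  let ?\<mu> = "inv_into N (emb \<circ> val)"
  note \<mu> = inv_into_emb_val[OF inj]
  obtain b where b: "lab g v = Some (Con b)" "val v = T b (map val (att g v))"
    using N val T.prems by (rule valuation_normal_part)
  have att: "set (att g v) \<subseteq> N" using N T.prems by (simp add: normal_part_def)
  then have "tm_match g ?\<mu> (emb (val u))" if "u \<in> set (att g v)" for u
    using T.hyps(1)[of u] T.hyps(2) b(2) that by auto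
  moreover have "map ?\<mu> (map emb (map val (att g v))) = att g v"
    using att \<mu> by (auto intro!: map_idI)
  moreover have "v \<in> nodes g" using N T.prems by (auto simp: normal_part_def)
  moreover have "emb (val v) = App (Con b) (map emb (map val (att g v)))"
    by (simp add: b(2))
  ultimately show ?case
    using b(1) \<mu>[OF T.prems] by (simp del: map_map)
qed

locale constructors =
  fixes cs :: "'c list" and ar :: "'c \<Rightarrow> nat"
begin

definition sig_of :: "'c program \<Rightarrow> 'c sig" where
  "sig_of P = \<lparr> cons = cs, car = ar, dfs = {..<length P},
     dar = (\<lambda>i. normals (P ! i) + safes (P ! i)), dnrm = (\<lambda>i. normals (P ! i)) \<rparr>"

definition equations :: "'c fundef \<Rightarrow> ('c sym tm list \<times> 'c sym tm) set" where
  "equations E = (case scheme E of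
      Explicit R \<Rightarrow> {(map Var [0..<normals E + safes E], R)}
    | Cases B \<Rightarrow>
        (\<lambda>c. (App (Con c) (map Var [0..<ar c]) # map Var [ar c..<ar c + (safes E - 1)], B c)) ` set cs
    | Recursion h \<Rightarrow> let m = normals E + safes E - 1 in
        (\<lambda>t. (emb t # map Var [0..<m], unfolding_tm h m t)) ` {t. gterm_ok cs ar t})"

definition scheme_ok :: "'c program \<Rightarrow> 'c fundef \<Rightarrow> bool" where
  "scheme_ok P E \<longleftrightarrow> (case scheme E of
      Explicit R \<Rightarrow> True
    | Cases B \<Rightarrow> normals E = 0 \<and> 0 < safes E
    | Recursion h \<Rightarrow> 0 < normals E \<and>
        (\<forall>c\<in>set cs. h c < length P \<and> normals (P ! h c) = ar c + (normals E - 1)))"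

definition total :: "'c fundef \<Rightarrow> bool" where
  "total E \<longleftrightarrow> (\<forall>xs ys. vargs cs ar (normals E) xs \<and> vargs cs ar (safes E) ys \<longrightarrow>
     gterm_ok cs ar (meaning E xs ys))"

definition equation_ok :: "'c program \<Rightarrow> 'c fundef \<Rightarrow> 'c sym tm list \<Rightarrow> 'c sym tm \<Rightarrow> bool" where
  "equation_ok P E args R \<longleftrightarrow> length args = normals E + safes E
     \<and> (\<forall>t\<in>set args. tm_ok (sig_of P) t \<and> set_tm t \<subseteq> Con ` set cs)
     \<and> tm_ok (sig_of P) R
     \<and> vars R \<subseteq> \<Union> (vars ` set args)
     \<and> tm_pt (sig_of P) (normals E) args R
     \<and> (\<forall>\<sigma> us. (\<forall>x\<in>\<Union> (vars ` set args). gterm_ok cs ar (\<sigma> x)) \<and> us = map (eval (interp P) \<sigma>) args \<longrightarrow>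
          meaning E (take (normals E) us) (drop (normals E) us) = eval (interp P) \<sigma> R)"

definition fundef_ok :: "'c program \<Rightarrow> 'c fundef \<Rightarrow> bool" where
  "fundef_ok P E \<longleftrightarrow> scheme_ok P E \<and> total E \<and> (\<forall>(args, R)\<in>equations E. equation_ok P E args R)"

definition program_ok :: "'c program \<Rightarrow> bool" where
  "program_ok P \<longleftrightarrow> (\<forall>i<length P. fundef_ok (take i P) (P ! i))"

definition term_rules :: "'c program \<Rightarrow> ('c sym tm \<times> 'c sym tm) set" where
  "term_rules P = {(App (Fn i) args, R) | i args R. i < length P \<and> (args, R) \<in> equations (P ! i)}"

definition grs_of :: "'c program \<Rightarrow> 'c sym rule set" where
  "grs_of P = case_prod tm_rule ` term_rules P"

lemma sig_of_simps [simp]: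
  "cons (sig_of P) = cs" "car (sig_of P) = ar" "dfs (sig_of P) = {..<length P}"
  "dar (sig_of P) i = normals (P ! i) + safes (P ! i)" "dnrm (sig_of P) i = normals (P ! i)"
  by (simp_all add: sig_of_def)

lemma Fsyms_sig_of [simp]:
  "Fn i \<in> Fsyms (sig_of P) \<longleftrightarrow> i < length P" "Con c \<in> Fsyms (sig_of P) \<longleftrightarrow> c \<in> set cs"
  by (auto simp: Fsyms_def)

lemma symbol_append:
  assumes "a \<in> Fsyms (sig_of P)"
  shows "a \<in> Fsyms (sig_of (P @ Q))" "sar (sig_of (P @ Q)) a = sar (sig_of P) a"
    "snn (sig_of (P @ Q)) a = snn (sig_of P) a" "interp (P @ Q) a = interp P a"
  using assms by (cases a; auto simp: nth_append fun_eq_iff)+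

lemma tm_ok_append: "tm_ok (sig_of P) t \<Longrightarrow> tm_ok (sig_of (P @ Q)) t"
  by (induction t) (auto simp: symbol_append)

lemma eval_append: "tm_ok (sig_of P) t \<Longrightarrow> eval (interp (P @ Q)) \<sigma> t = eval (interp P) \<sigma> t"
proof (induction t)
  case (App a ts)
  then have "map (eval (interp (P @ Q)) \<sigma>) ts = map (eval (interp P) \<sigma>) ts" by auto
  then show ?case using App.prems by (simp add: symbol_append del: map_eq_conv)
qed simp

lemma tm_pt_append: "tm_pt (sig_of P) k args R \<Longrightarrow> tm_ok (sig_of P) R \<Longrightarrow> tm_pt (sig_of (P @ Q)) k args R"
proof (induction rule: tm_pt.induct)
  case (app a ts)
  have a: "snn (sig_of (P @ Q)) a = snn (sig_of P) a" using app.prems by (simp add: symbol_append)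
  show ?case
    by (rule tm_pt.app) (use app a in \<open>auto dest: in_set_dropD\<close>)
qed (auto intro: tm_pt.intros)

lemma equation_ok_append:
  assumes ok: "equation_ok P E args R"
  shows "equation_ok (P @ Q) E args R"
proof -
  have "map (eval (interp (P @ Q)) \<sigma>) args = map (eval (interp P) \<sigma>) args"
    "eval (interp (P @ Q)) \<sigma> R = eval (interp P) \<sigma> R" for \<sigma>
    using ok by (auto simp: equation_ok_def eval_append)
  then show ?thesis
    using ok by (simp add: equation_ok_def tm_ok_append tm_pt_append del: map_eq_conv)
qed

lemma scheme_ok_append: "scheme_ok P E \<Longrightarrow> scheme_ok (P @ Q) E"
  by (auto simp: scheme_ok_def nth_append split: scheme.splits)

lemma fundef_ok_append: "fundef_ok P E \<Longrightarrow> fundef_ok (P @ Q) E"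
  by (auto simp: fundef_ok_def scheme_ok_append equation_ok_append)

lemma program_ok_snoc:
  assumes "program_ok P" and "fundef_ok P E"
  shows "program_ok (P @ [E])"
  using assms by (auto simp: program_ok_def nth_append less_Suc_eq)

lemma fundef_ok_nth:
  assumes "program_ok P" and "i < length P"
  shows "fundef_ok P (P ! i)"
proof -
  have "fundef_ok (take i P @ drop i P) (P ! i)"
    using assms by (intro fundef_ok_append) (simp add: program_ok_def)
  then show ?thesis by simp
qed

lemma symbols_earlier:
  assumes "program_ok P" and "i < length P" and "(args, R) \<in> equations (P ! i)"
  shows "set_tm R \<subseteq> {a. (a, Fn i) \<in> measure sym_rank}"
proof
  fix a assume a: "a \<in> set_tm R"
  have "equation_ok (take i P) (P ! i) args R"
    using assms by (auto simp: program_ok_def fundef_ok_def)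
  then have "a \<in> Fsyms (sig_of (take i P))"
    using a set_tm_subset_Fsyms[of "sig_of (take i P)" R] by (auto simp: equation_ok_def)
  then show "a \<in> {a. (a, Fn i) \<in> measure sym_rank}"
    by (cases a) auto
qed

lemma term_rulesE:
  assumes "program_ok P" and "(L, R) \<in> term_rules P"
  obtains i args where "i < length P" "L = App (Fn i) args" "(args, R) \<in> equations (P ! i)"
    "equation_ok P (P ! i) args R" "set_tm R \<subseteq> {a. (a, Fn i) \<in> measure sym_rank}"
proof -
  obtain i args where i: "i < length P" "L = App (Fn i) args" "(args, R) \<in> equations (P ! i)"
    using assms(2) by (auto simp: term_rules_def)
  moreover have "equation_ok P (P ! i) args R"
    using fundef_ok_nth[OF assms(1) i(1)] i(3) by (auto simp: fundef_ok_def)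
  ultimately show ?thesis using that symbols_earlier[OF assms(1)] by blast
qed

lemma term_rules_ok:
  assumes "program_ok P" and "(L, R) \<in> term_rules P"
  shows "tm_ok (sig_of P) L" and "tm_ok (sig_of P) R" and "vars R \<subseteq> vars L" and "L \<notin> subterms R"
    and "(\<And>x. x \<in> vars L \<Longrightarrow> gterm_ok cs ar (\<sigma> x)) \<Longrightarrow> eval (interp P) \<sigma> L = eval (interp P) \<sigma> R"
proof -
  obtain i args where i: "i < length P" "L = App (Fn i) args" "equation_ok P (P ! i) args R"
    "set_tm R \<subseteq> {a. (a, Fn i) \<in> measure sym_rank}"
    using assms by (rule term_rulesE)
  show "tm_ok (sig_of P) L" and "tm_ok (sig_of P) R" and "vars R \<subseteq> vars L"
    using i by (auto simp: equation_ok_def)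
  show "eval (interp P) \<sigma> L = eval (interp P) \<sigma> R" if "\<And>x. x \<in> vars L \<Longrightarrow> gterm_ok cs ar (\<sigma> x)"
  proof -
    have "\<forall>x\<in>\<Union> (vars ` set args). gterm_ok cs ar (\<sigma> x)" using that i(2) by auto
    then show ?thesis using i(2,3) by (simp add: equation_ok_def)
  qed
  have "Fn i \<notin> set_tm R" using i(4) by auto
  then show "L \<notin> subterms R" using i(2) set_tm_subterm[of L R] by auto
qed

lemma constructor_grs_grs_of:
  assumes "program_ok P"
  shows "constructor_grs (sig_of P) (grs_of P)"
proof -
  have "rule_ok (sig_of P) (tm_rule L R) \<and> basic (sig_of P) (lhsG (tm_rule L R))"
    if LR: "(L, R) \<in> term_rules P" for L R
  proof
    obtain i args where i: "i < length P" "L = App (Fn i) args" "equation_ok P (P ! i) args R"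
      using assms LR by (rule term_rulesE)
    show "rule_ok (sig_of P) (tm_rule L R)"
      using term_rules_ok[OF assms LR] by (intro rule_ok_tm_rule) auto
    show "basic (sig_of P) (lhsG (tm_rule L R))"
      unfolding lhsG_tm_rule i(2) tm_rule_sel
      by (rule rule.basic_restr_tm_graph) (use i in \<open>auto simp: equation_ok_def simp del: subterms.simps\<close>)
  qed
  then show ?thesis by (auto simp: constructor_grs_def grs_of_def)
qed

lemma pt_sep_grs_of:
  assumes "program_ok P"
  shows "pt_sep (sig_of P) (grs_of P)"
proof -
  let ?Q = "measure sym_rank :: 'c sym rel"
  have "pt (sig_of P) ?Q (rhsG (tm_rule L R)) (lhsG (tm_rule L R))"
    if LR: "(L, R) \<in> term_rules P" for L R
  proof -
    obtain i args where i: "L = App (Fn i) args" "equation_ok P (P ! i) args R"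
      "set_tm R \<subseteq> {a. (a, Fn i) \<in> ?Q}"
      using assms LR by (rule term_rulesE)
    then show ?thesis
      unfolding lhsG_tm_rule rhsG_tm_rule i(1) tm_rule_sel
      by (intro rule.pt_restr_tm_graph) (auto simp: equation_ok_def simp del: subterms.simps)
  qed
  moreover have "precedence ?Q"
    by (auto simp: precedence_def intro!: transI)
  ultimately show ?thesis by (auto simp: pt_sep_def grs_of_def)
qed

section \<open>Computations of a program\<close>

lemma gterm_ok_interp:
  assumes "program_ok P" and "a \<in> Fsyms (sig_of P)"
    and "length us = sar (sig_of P) a" and "\<And>u. u \<in> set us \<Longrightarrow> gterm_ok cs ar u"
  shows "gterm_ok cs ar (interp P a us)"
proof (cases a)
  case (Fn i)
  then have "total (P ! i)" using assms(1,2) fundef_ok_nth by (simp add: fundef_ok_def)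
  moreover have "vargs cs ar (normals (P ! i)) (take (normals (P ! i)) us)"
    "vargs cs ar (safes (P ! i)) (drop (normals (P ! i)) us)"
    using Fn assms(3,4) by (auto simp: vargs_def dest: in_set_takeD in_set_dropD)
  ultimately show ?thesis
    using Fn by (simp add: total_def)
qed (use assms in auto)

lemma gterm_ok_eval:
  assumes P: "program_ok P"
  shows "tm_ok (sig_of P) t \<Longrightarrow> (\<And>x. x \<in> vars t \<Longrightarrow> gterm_ok cs ar (\<sigma> x)) \<Longrightarrow>
    gterm_ok cs ar (eval (interp P) \<sigma> t)"
proof (induction t)
  case (App a ts)
  then have "gterm_ok cs ar (eval (interp P) \<sigma> t)" if "t \<in> set ts" for t using that by auto
  then show ?case using App.prems by (auto intro!: gterm_ok_interp[OF P])
qed simp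

lemma gterm_ok_valuation:
  assumes P: "program_ok P" and ok: "lgraph_ok (sig_of P) g" and val: "valuation (interp P) g val"
    and labeled: "\<And>v. v \<in> nodes g \<Longrightarrow> lab g v \<noteq> None"
  shows "v \<in> nodes g \<Longrightarrow> gterm_ok cs ar (val v)"
  using wf_edges_converse[OF ok]
proof (induction v rule: wf_induct_rule)
  case (less v)
  obtain a where a: "lab g v = Some a" using labeled less.prems by blast
  note v = lgraph_okD[OF ok less.prems]
  have "gterm_ok cs ar (interp P a (map val (att g v)))"
    using v(2,3)[OF a] v(1) less by (intro gterm_ok_interp[OF P]) (auto simp: edges_def)
  then show ?case using val less.prems a by (simp add: valuation_def)
qed

text \<open>Here \<open>val\<close> assigns to each node the value that it will eventually be rewritten to. Since it is
  injective on \<open>N\<close>, the normal arguments stay maximally shared and the left-hand sides of recursion rules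
  keep matching.\<close>

definition configuration :: "'c program \<Rightarrow> 'c gterm \<Rightarrow> 'c sym tgraph \<Rightarrow> bool" where
  "configuration P x G \<longleftrightarrow> tgraph_ok (sig_of P) G \<and> closed G \<and>
     (\<exists>N val. normal_part (sig_of P) N (gr G) \<and> inj_on val N
        \<and> valuation (interp P) (gr G) val \<and> val (root G) = x)"

lemma rstep_grs_ofE:
  assumes P: "program_ok P" and ok: "lgraph_ok (sig_of P) (gr G)" and step: "rstep (grs_of P) G H"
  obtains L R \<mu> where "(L, R) \<in> term_rules P" "tm_step (sig_of P) (gr G) \<mu> L R"
    "H = restr (build (gr G) \<mu> L R) ((id(\<mu> L := \<mu> R)) (root G))"
proof -
  obtain L R \<mu> where LR: "(L, R) \<in> term_rules P" and match: "tm_match (gr G) \<mu> L"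
    and new: "inj_on \<mu> (subterms R - subterms L)" "\<mu> ` (subterms R - subterms L) \<inter> nodes (gr G) = {}"
    and H: "H = restr (build (gr G) \<mu> L R) ((id(\<mu> L := \<mu> R)) (root G))"
    using step unfolding grs_of_def by (rule rstep_tm_rules_cases)
  have "tm_step (sig_of P) (gr G) \<mu> L R"
    using ok match new term_rules_ok[OF P LR] by unfold_locales
  with LR H show ?thesis using that by blast
qed

lemma label_mset_rstep:
  assumes P: "program_ok P" and G: "tgraph_ok (sig_of P) G" and step: "rstep (grs_of P) G H"
  shows "(label_mset (gr H), label_mset (gr G)) \<in> mult (measure sym_rank)"
proof -
  have ok: "lgraph_ok (sig_of P) (gr G)" and root: "root G \<in> nodes (gr G)"
    using G by (simp_all add: tgraph_ok_def)
  obtain L R \<mu> where LR: "(L, R) \<in> term_rules P" and tm_step: "tm_step (sig_of P) (gr G) \<mu> L R"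
    and H: "H = restr (build (gr G) \<mu> L R) ((id(\<mu> L := \<mu> R)) (root G))"
    using P ok step by (rule rstep_grs_ofE)
  obtain i args where "L = App (Fn i) args" and "set_tm R \<subseteq> {a. (a, Fn i) \<in> measure sym_rank}"
    using P LR by (rule term_rulesE)
  then show ?thesis
    unfolding H using root
    by (intro tm_step.label_mset_build[OF tm_step, where f = "Fn i"]) simp_all
qed

lemma configuration_rstep:
  assumes P: "program_ok P" and conf: "configuration P x G" and step: "rstep (grs_of P) G H"
  shows "configuration P x H"
proof -
  obtain N val where ok: "lgraph_ok (sig_of P) (gr G)" and root: "root G \<in> nodes (gr G)"
    and labeled: "\<And>v. v \<in> nodes (gr G) \<Longrightarrow> lab (gr G) v \<noteq> None"
    and N: "normal_part (sig_of P) N (gr G)" "inj_on val N"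
    and val: "valuation (interp P) (gr G) val" "val (root G) = x"
    using conf by (auto simp: configuration_def tgraph_ok_def closed_def)
  obtain L R \<mu> where LR: "(L, R) \<in> term_rules P" and tm_step: "tm_step (sig_of P) (gr G) \<mu> L R"
    and H: "H = restr (build (gr G) \<mu> L R) ((id(\<mu> L := \<mu> R)) (root G))"
    using P ok step by (rule rstep_grs_ofE)
  interpret tm_step "sig_of P" "gr G" \<mu> L R by (rule tm_step)
  obtain i args where L: "L = App (Fn i) args" and eq: "equation_ok P (P ! i) args R"
    using P LR by (rule term_rulesE)
  have "gterm_ok cs ar (val (\<mu> (Var x)))" if "x \<in> vars L" for x
    using that matched[of "Var x"] gterm_ok_valuation[OF P ok val(1) labeled]
    by (simp add: in_vars_iff)
  then obtain val' where val': "valuation (interp P) g' val'" "\<And>v. v \<in> nodes (gr G) \<Longrightarrow> val' v = val v"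
    "\<And>v. v \<in> nodes (gr G) \<Longrightarrow> val' (red v) = val v"
    using valuation_build[OF val(1) term_rules_ok(5)[OF P LR]] by blast
  have reach: "reach g' (red (root G)) \<subseteq> nodes g'"
    using reach_build[OF root] by (auto simp: nodes_build)
  have "tgraph_ok (sig_of P) H"
    unfolding H using lgraph_ok_build reach reach_refl by (intro tgraph_ok_restr) blast+
  moreover have "closed H"
    unfolding H closed_def using labeled_build[OF labeled] reach by (auto simp del: fun_upd_apply)
  moreover have "normal_part (sig_of P) (N \<inter> reach g' (red (root G))) (gr H)"
    unfolding H using reach eq
    by (intro normal_part_restr normal_part_build[OF N(1) L]) (simp_all add: equation_ok_def)
  moreover have "inj_on val' N"
    using N val'(2) inj_on_cong[of N val' val] by (auto simp: normal_part_def)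
  then have "inj_on val' (N \<inter> reach g' (red (root G)))"
    by (rule inj_on_subset) blast
  moreover have "valuation (interp P) (gr H) val'"
    unfolding H using val'(1) reach by (rule valuation_restr)
  moreover have "val' (root H) = x"
    unfolding H using val'(3)[OF root] val(2) by simp
  ultimately show ?thesis
    unfolding configuration_def by blast
qed

lemma equation_matches_Cases:
  assumes ok: "lgraph_ok (sig_of P) g" and E: "scheme E = Cases B" "scheme_ok P E"
    and v: "v \<in> nodes g" "lab g v = Some f" "length (att g v) = normals E + safes E"
    and con: "\<And>u. u \<in> set (att g v) \<Longrightarrow> lab g u \<in> Some ` range Con"
  shows "\<exists>args R \<mu>. (args, R) \<in> equations E \<and> tm_match g \<mu> (App f args)"
proof -
  obtain w us where wus: "att g v = w # us" and len: "length us = safes E - 1"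
    using E v(3) by (cases "att g v") (auto simp: scheme_ok_def)
  have att: "set (att g v) \<subseteq> nodes g" using ok v(1) by (rule lgraph_okD)
  then have w: "w \<in> nodes g" using wus by simp
  moreover obtain c where c: "lab g w = Some (Con c)" using con[of w] wus by auto
  ultimately have "set (att g w) \<subseteq> nodes g" "length (att g w) = ar c" "c \<in> set cs"
    using lgraph_okD[OF ok w] by auto
  then obtain \<nu> where \<nu>: "tm_match g \<nu> (App (Con c) (map Var [0..<ar c]))"
    "\<nu> (App (Con c) (map Var [0..<ar c])) = w"
    using tm_match_append_vars[OF w c, of \<nu> "[]" "att g w" 0] by auto
  then have "att g v = map \<nu> [App (Con c) (map Var [0..<ar c])] @ us"
    using wus by simp
  then obtain \<mu> where
    "tm_match g \<mu> (App f ([App (Con c) (map Var [0..<ar c])] @ map Var [ar c..<ar c + length us]))"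
    using tm_match_append_vars[OF v(1,2), of \<nu> "[App (Con c) (map Var [0..<ar c])]" us "ar c"] \<nu>(1) att wus
    by (auto simp: atLeast0LessThan simp del: tm_match.simps)
  moreover have
    "([App (Con c) (map Var [0..<ar c])] @ map Var [ar c..<ar c + length us], B c) \<in> equations E"
    using E(1) \<open>c \<in> set cs\<close> len by (simp add: equations_def)
  ultimately show ?thesis by blast
qed

lemma equation_matches_Recursion:
  assumes E: "scheme E = Recursion h" "scheme_ok P E"
    and N: "normal_part (sig_of P) N g" "inj_on val N" and val: "valuation (interp P) g val"
    and v: "v \<in> nodes g" "lab g v = Some f" "length (att g v) = normals E + safes E"
      "set (att g v) \<subseteq> nodes g"
    and normal: "set (take (normals E) (att g v)) \<subseteq> N"
    and valid: "\<And>u. u \<in> N \<Longrightarrow> gterm_ok cs ar (val u)"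
  shows "\<exists>args R \<mu>. (args, R) \<in> equations E \<and> tm_match g \<mu> (App f args)"
proof -
  obtain w us where wus: "att g v = w # us" and len: "length us = normals E + safes E - 1"
    using E v(3) by (cases "att g v") (auto simp: scheme_ok_def)
  have w: "w \<in> N"
    using normal wus E by (cases "normals E") (auto simp: scheme_ok_def)
  have "tm_match g (inv_into N (emb \<circ> val)) (emb (val w))"
    using N(1) val N(2) w by (rule match_normal_part)
  moreover have "att g v = map (inv_into N (emb \<circ> val)) [emb (val w)] @ us"
    using wus inv_into_emb_val[OF N(2) w] by simp
  ultimately obtain \<mu> where "tm_match g \<mu> (App f ([emb (val w)] @ map Var [0..<0 + length us]))"
    using tm_match_append_vars[OF v(1,2), of "inv_into N (emb \<circ> val)" "[emb (val w)]" us 0] v(4) wus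
    by (auto simp del: tm_match.simps)
  moreover have
    "([emb (val w)] @ map Var [0..<0 + length us], unfolding_tm h (length us) (val w)) \<in> equations E"
    using E(1) len valid[OF w] by (simp add: equations_def Let_def)
  ultimately show ?thesis by blast
qed

lemma equation_matches:
  assumes P: "program_ok P" and ok: "lgraph_ok (sig_of P) g"
    and N: "normal_part (sig_of P) N g" "inj_on val N" and val: "valuation (interp P) g val"
    and labeled: "\<And>v. v \<in> nodes g \<Longrightarrow> lab g v \<noteq> None"
    and v: "v \<in> nodes g" "lab g v = Some (Fn i)"
    and con: "\<And>u. u \<in> set (att g v) \<Longrightarrow> lab g u \<in> Some ` range Con"
  shows "\<exists>args R \<mu>. (args, R) \<in> equations (P ! i) \<and> tm_match g \<mu> (App (Fn i) args)"
proof -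
  have att: "set (att g v) \<subseteq> nodes g" and "i < length P"
    and len: "length (att g v) = normals (P ! i) + safes (P ! i)"
    using lgraph_okD[OF ok v(1)] v(2) by auto
  then have scheme: "scheme_ok P (P ! i)"
    using fundef_ok_nth[OF P] by (simp add: fundef_ok_def)
  show ?thesis
  proof (cases "scheme (P ! i)")
    case (Explicit R)
    then show ?thesis
      using len tm_match_append_vars[OF v, of \<nu> "[]" "att g v" 0] att by (auto simp: equations_def)
  next
    case (Cases B)
    then show ?thesis using ok scheme v len con by (intro equation_matches_Cases)
  next
    case (Recursion h)
    have "nrm (sig_of P) g v = take (normals (P ! i)) (att g v)" using v(2) by (simp add: nrm_def)
    moreover have "set (nrm (sig_of P) g v) \<subseteq> N" using N(1) v(1) by (simp add: normal_part_def)
    ultimately have "set (take (normals (P ! i)) (att g v)) \<subseteq> N" by simp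
    moreover have "gterm_ok cs ar (val u)" if "u \<in> N" for u
      using that N(1) gterm_ok_valuation[OF P ok val labeled] by (auto simp: normal_part_def)
    ultimately show ?thesis
      using Recursion scheme N val v len att by (intro equation_matches_Recursion)
  qed
qed

lemma progress:
  assumes P: "program_ok P" and conf: "configuration P x G"
    and "u \<in> nodes (gr G)" and "lab (gr G) u = Some (Fn j)"
  shows "\<exists>H. rstep (grs_of P) G H"
proof -
  let ?g = "gr G"
  obtain N val where ok: "lgraph_ok (sig_of P) ?g"
    and labeled: "\<And>v. v \<in> nodes ?g \<Longrightarrow> lab ?g v \<noteq> None"
    and N: "normal_part (sig_of P) N ?g" "inj_on val N" and val: "valuation (interp P) ?g val"
    using conf by (auto simp: configuration_def tgraph_ok_def closed_def)
  let ?D = "{v\<in>nodes ?g. lab ?g v \<in> Some ` range Fn}"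
  have "u \<in> ?D" using assms(3,4) by auto
  then obtain v where v: "v \<in> ?D" and innermost: "\<And>w. (w, v) \<in> (edges ?g)\<inverse> \<Longrightarrow> w \<notin> ?D"
    by (rule wfE_min[OF wf_edges_converse[OF ok]]) blast
  then obtain i where i: "v \<in> nodes ?g" "lab ?g v = Some (Fn i)" by auto
  have "lab ?g w \<in> Some ` range Con" if "w \<in> set (att ?g v)" for w
  proof -
    have w: "w \<in> nodes ?g" using that lgraph_okD(1)[OF ok i(1)] by auto
    then obtain a where a: "lab ?g w = Some a" using labeled by blast
    have "w \<notin> ?D" using that i(1) by (intro innermost) (simp add: edges_def)
    then show ?thesis using a w by (cases a) auto
  qed
  then obtain args R \<mu> where "(args, R) \<in> equations (P ! i)" and match: "tm_match ?g \<mu> (App (Fn i) args)"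
    using equation_matches[OF P ok N val labeled i] by blast
  then have "(App (Fn i) args, R) \<in> term_rules P"
    using lgraph_okD(2)[OF ok i] by (auto simp: term_rules_def)
  then show ?thesis
    unfolding grs_of_def using ok
    by (intro rstep_tm_rules_if_match[OF _ match]) (simp_all add: lgraph_ok_def)
qed

lemma configuration_normal_form:
  assumes P: "program_ok P" and conf: "configuration P x H" and nf: "\<nexists>H'. rstep (grs_of P) H H'"
  shows "closed H" and "over_C (sig_of P) H" and "repr (gr H) (root H) (emb x)"
proof -
  obtain val where ok: "lgraph_ok (sig_of P) (gr H)" and root: "root H \<in> nodes (gr H)"
    and "closed H" and val: "valuation (interp P) (gr H) val" "val (root H) = x"
    using conf by (auto simp: configuration_def tgraph_ok_def)
  show "closed H" by fact
  have con: "\<exists>c\<in>set cs. lab (gr H) v = Some (Con c)" if v: "v \<in> nodes (gr H)" for v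
  proof -
    obtain a where a: "lab (gr H) v = Some a" using v \<open>closed H\<close> by (auto simp: closed_def)
    then show ?thesis
      using progress[OF P conf v] nf lgraph_okD(2)[OF ok v a] by (cases a) auto
  qed
  then show "over_C (sig_of P) H" by (fastforce simp: over_C_def)
  have "normal_part (sig_of P) (nodes (gr H)) (gr H)"
    using con lgraph_okD(1)[OF ok] by (fastforce simp: normal_part_def nrm_def)
  then show "repr (gr H) (root H) (emb x)"
    using repr_normal_part[OF _ val(1) root] val(2) by simp
qed

lemma configuration_initial:
  assumes G: "tgraph_ok (sig_of P) G" "closed G" "basic (sig_of P) G" "max_shared G"
    and repr: "repr (gr G) (root G) (App (Fn f) (map emb ts))"
  shows "configuration P (interp P (Fn f) ts) G"
proof -
  let ?g = "gr G"
  let ?N = "nodes ?g - {root G}"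
  have ok: "lgraph_ok (sig_of P) ?g"
    using G(1) by (simp add: tgraph_ok_def)
  obtain val where val: "valuation (interp P) ?g val"
    and eval: "\<And>v t. repr ?g v t \<Longrightarrow> val v = eval (interp P) (\<lambda>_. undefined) t"
    using valuation_exists[OF ok, of "interp P" "\<lambda>_. undefined"] by blast
  have "map (eval (interp P) \<sigma>) (map emb ts) = ts" for \<sigma>
    by (simp add: eval_emb map_idI)
  then have "val (root G) = interp P (Fn f) ts"
    using eval[OF repr] by (simp only: eval.simps)
  moreover have N: "normal_part (sig_of P) ?N ?g"
    using G by (intro normal_part_basic)
  moreover have "inj_on val ?N"
    using repr_normal_part[OF N val] G(4) by (auto simp: max_shared_def inj_on_def) metis
  ultimately show ?thesis
    using G val unfolding configuration_def by blast
qed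

lemma grs_of_computes:
  assumes P: "program_ok P" and f: "f < length P"
  shows "computes (sig_of P) (grs_of P) (normals (P ! f)) (safes (P ! f)) (meaning (P ! f))"
  unfolding computes_def
proof (intro bexI[of _ f] conjI allI impI)
  fix xs ys G
  assume input: "vargs (cons (sig_of P)) (car (sig_of P)) (normals (P ! f)) xs
      \<and> vargs (cons (sig_of P)) (car (sig_of P)) (safes (P ! f)) ys
      \<and> tgraph_ok (sig_of P) G \<and> closed G \<and> basic (sig_of P) G \<and> max_shared G
      \<and> repr (gr G) (root G) (App (Fn f) (map emb (xs @ ys)))"
  let ?x = "meaning (P ! f) xs ys"
  have "interp P (Fn f) (xs @ ys) = ?x" using input by (auto simp: vargs_def)
  then have G: "configuration P ?x G"
    using input configuration_initial[of P G f "xs @ ys"] by simp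
  show "\<nexists>s. s 0 = G \<and> (\<forall>i. rstep (grs_of P) (s i) (s (Suc i)))"
  proof
    assume "\<exists>s. s 0 = G \<and> (\<forall>i. rstep (grs_of P) (s i) (s (Suc i)))"
    then obtain s where s: "s 0 = G" "\<And>i. rstep (grs_of P) (s i) (s (Suc i))" by blast
    have "configuration P ?x (s i)" for i
      by (induction i) (use G s configuration_rstep[OF P] in auto)
    then have "(label_mset (gr (s (Suc i))), label_mset (gr (s i))) \<in> mult (measure sym_rank)" for i
      using label_mset_rstep[OF P] s(2) by (simp add: configuration_def)
    moreover have "wf (mult (measure sym_rank))" by (simp add: wf_mult)
    ultimately show False
      using wf_no_infinite_down_chainE[of _ "\<lambda>i. label_mset (gr (s i))"] by blast
  qed
  fix H
  assume H: "(rstep (grs_of P))\<^sup>*\<^sup>* G H \<and> (\<nexists>H'. rstep (grs_of P) H H')"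
  then have "(rstep (grs_of P))\<^sup>*\<^sup>* G H" ..
  then have "configuration P ?x H"
    by induction (use G configuration_rstep[OF P] in auto)
  then show "closed H" "over_C (sig_of P) H" "repr (gr H) (root H) (emb ?x)"
    using configuration_normal_form[OF P] H by blast+
qed (use f in auto)

end

section \<open>Size bounds\<close>

lemma finite_Gfin:
  assumes "finite F" and "\<And>r. r \<in> Gs \<Longrightarrow> lab (rg r) (lhs r) \<in> Some ` F"
  shows "finite (Gfin Gs)"
proof (rule finite_subset)
  show "Gfin Gs \<subseteq> (\<Union>a\<in>F - Dinf Gs. {r\<in>Gs. lab (rg r) (lhs r) = Some a})"
    using assms(2) by (fastforce simp: Gfin_def Ginf_def)
  show "finite (\<Union>a\<in>F - Dinf Gs. {r\<in>Gs. lab (rg r) (lhs r) = Some a})"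
    using assms(1) by (auto simp: Dinf_def)
qed

lemma subterms_unfolding_tm:
  "subterms (unfolding_tm h m t) \<subseteq> unfolding_tm h m ` {u. emb u \<in> subterms (emb t)}
     \<union> \<Union> (subterms ` set (tm_att (emb t))) \<union> Var ` {..<m}"
proof (induction t)
  case (T c ts)
  define B where "B = unfolding_tm h m ` {u. emb u \<in> subterms (emb (T c ts))}
    \<union> \<Union> (subterms ` set (tm_att (emb (T c ts)))) \<union> Var ` {..<m}"
  have arg: "subterms (emb u) \<subseteq> B" if "u \<in> set ts" for u
    using that by (auto simp: B_def)
  have unfolding_arg: "subterms (unfolding_tm h m u) \<subseteq> B" if u: "u \<in> set ts" for u
  proof -
    have "{w. emb w \<in> subterms (emb u)} \<subseteq> {w. emb w \<in> subterms (emb (T c ts))}" using u by auto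
    then have "unfolding_tm h m ` {w. emb w \<in> subterms (emb u)} \<subseteq> B" unfolding B_def by blast
    moreover have "subterms s \<subseteq> B" if "s \<in> set (tm_att (emb u))" for s
      using that arg[OF u] subterms_subset[of s "emb u"] tm_att_subset_subterms[of "emb u"] by auto
    then have "\<Union> (subterms ` set (tm_att (emb u))) \<subseteq> B" by (rule UN_least)
    moreover have "Var ` {..<m} \<subseteq> B" unfolding B_def by blast
    ultimately show ?thesis by (intro order.trans[OF T.IH[OF u]] Un_least)
  qed
  have "unfolding_tm h m (T c ts) \<in> B"
    unfolding B_def by (intro UnI1 imageI CollectI) (rule subterms_refl)
  moreover have "Var ` {..<m} \<subseteq> B" unfolding B_def by blast
  ultimately have "subterms (unfolding_tm h m (T c ts)) \<subseteq> B"
    using arg unfolding_arg by (simp add: UN_subset_iff image_subset_iff)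
  then show ?case unfolding B_def .
qed

lemma card_subterms_unfolding_tm:
  "card (subterms (unfolding_tm h m t))
    \<le> card (subterms (emb t)) + card (\<Union> (subterms ` set (tm_att (emb t)))) + m"
proof -
  let ?U = "{u. emb u \<in> subterms (emb t)}" and ?B = "\<Union> (subterms ` set (tm_att (emb t)))"
  have "finite (emb ` ?U)" by (rule finite_subset[of _ "subterms (emb t)"]) auto
  then have fin: "finite ?U" by (rule finite_imageD) (rule inj_on_subset[OF inj_emb], simp)
  have "card ?U = card (emb ` ?U)"
    by (rule card_image[symmetric]) (rule inj_on_subset[OF inj_emb], simp)
  also have "\<dots> \<le> card (subterms (emb t))" by (intro card_mono) auto
  finally have "card (unfolding_tm h m ` ?U) \<le> card (subterms (emb t))"
    using card_image_le[OF fin] order_trans by blast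
  moreover have "card (Var ` {..<m} :: 'a sym tm set) \<le> m"
    using card_image_le[of "{..<m}" Var] by simp
  moreover have "card (subterms (unfolding_tm h m t)) \<le> card (unfolding_tm h m ` ?U \<union> ?B \<union> Var ` {..<m})"
    using subterms_unfolding_tm by (rule card_mono[rotated]) (use fin in simp)
  moreover have "\<dots> \<le> card (unfolding_tm h m ` ?U) + card ?B + card (Var ` {..<m} :: 'a sym tm set)"
    by (meson add_le_mono card_Un_le le_refl le_trans)
  ultimately show ?thesis by linarith
qed

lemma card_subterms_emb_vars:
  "card (subterms (emb t)) + m \<le> card (subterms (App f (emb t # map Var [0..<m])))"
proof -
  have "Var x \<notin> subterms (emb t)" for x
    using vars_emb in_vars_iff by (metis empty_iff)
  then have "card (subterms (emb t) \<union> Var ` {..<m})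
      = card (subterms (emb t)) + card (Var ` {..<m} :: 'a sym tm set)"
    by (intro card_Un_disjoint) auto
  moreover have "card (Var ` {..<m} :: 'a sym tm set) = m"
    by (simp add: card_image inj_on_def)
  moreover have "card (subterms (emb t) \<union> Var ` {..<m}) \<le> card (subterms (App f (emb t # map Var [0..<m])))"
    by (intro card_mono) auto
  ultimately show ?thesis by simp
qed

context constructors
begin

lemma inf_rule_conds_Recursion:
  assumes E: "scheme (P ! i) = Recursion h" "scheme_ok P (P ! i)" and t: "gterm_ok cs ar t"
    and m: "m = normals (P ! i) + safes (P ! i) - 1" "m \<le> d"
  shows "inf_rule_conds (sig_of P) d (tm_rule (App (Fn i) (emb t # map Var [0..<m])) (unfolding_tm h m t))"
proof -
  obtain c ts where tc: "t = T c ts" by (cases t)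
  let ?args = "emb t # map Var [0..<m]"
  let ?us = "map emb ts @ map Var [0..<m] @ map (unfolding_tm h m) ts"
  have pos: "0 < normals (P ! i)" and h: "normals (P ! h c) = length ts + (normals (P ! i) - 1)"
    using E t tc by (auto simp: scheme_ok_def)
  have "tm_att (emb t) = map emb ts" by (simp add: tc)
  then have "\<Union> (subterms ` set (tm_att (emb t)))
      \<subseteq> \<Union> (subterms ` set (take (snn (sig_of P) (Fn (h c))) ?us))" (is "?A \<subseteq> ?B")
    using h by auto
  then have "card ?A \<le> card ?B" by (intro card_mono) auto
  then have size: "card (subterms (App (Fn (h c)) ?us)) \<le> card (subterms (App (Fn i) ?args)) + card ?B"
    using card_subterms_unfolding_tm[of h m t] card_subterms_emb_vars[of t m "Fn i"]
    unfolding tc unfolding_tm.simps by linarith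
  have "drop (snn (sig_of P) (Fn i)) ?args = drop (normals (P ! i) - 1) (map Var [0..<m])"
    using pos by (cases "normals (P ! i)") auto
  then have "set (drop (snn (sig_of P) (Fn i)) ?args) \<subseteq> range Var"
    by (auto dest!: in_set_dropD)
  moreover have "vars s = {}"
    if "s \<in> set (take (snn (sig_of P) (Fn i)) ?args)" "s \<notin> range Var" for s
    using in_set_takeD[OF that(1)] that(2) by auto
  moreover have "vars (App (Fn i) ?args) = {..<m}" by auto
  ultimately show ?thesis
    unfolding tm_rule_def tc unfolding_tm.simps using size[unfolded tc] m(2)
    by (intro rule.inf_rule_conds_tm_graph) auto
qed

lemma Ginf_grs_ofE:
  assumes "r \<in> Ginf (grs_of P)"
  obtains i h t m where "i < length P" "scheme (P ! i) = Recursion h" "gterm_ok cs ar t"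
    "m = normals (P ! i) + safes (P ! i) - 1"
    "r = tm_rule (App (Fn i) (emb t # map Var [0..<m])) (unfolding_tm h m t)"
proof -
  obtain i args R where i: "i < length P" "(args, R) \<in> equations (P ! i)"
    and r: "r = tm_rule (App (Fn i) args) R"
    using assms by (auto simp: Ginf_def grs_of_def term_rules_def)
  have root: "lab (rg (tm_rule (App a us) S)) (lhs (tm_rule (App a us) S)) = Some a"
    for a us and S :: "'c sym tm"
    using rule.lab_tm_graph[of "App a us" "App a us" S] by simp
  then have "infinite {r\<in>grs_of P. lab (rg r) (lhs r) = Some (Fn i)}"
    using assms unfolding r Ginf_def Dinf_def by (auto simp del: tm_rule_sel)
  moreover have "{r\<in>grs_of P. lab (rg r) (lhs r) = Some (Fn i)}
      \<subseteq> (\<lambda>(args, R). tm_rule (App (Fn i) args) R) ` equations (P ! i)"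
    using root by (auto simp: grs_of_def term_rules_def simp del: tm_rule_sel)
  ultimately have "infinite (equations (P ! i))" using finite_surj by blast
  then obtain h where "scheme (P ! i) = Recursion h"
    by (cases "scheme (P ! i)") (auto simp: equations_def)
  then show ?thesis
    using that i r by (auto simp: equations_def Let_def)
qed

lemma grs_of_bounds:
  assumes P: "program_ok P"
  shows "\<exists>d. (\<forall>a\<in>Fsyms (sig_of P). sar (sig_of P) a \<le> d) \<and> (\<forall>r\<in>Gfin (grs_of P). gsize (rhsG r) \<le> d)
    \<and> (\<forall>r\<in>Ginf (grs_of P). inf_rule_conds (sig_of P) d r)"
proof -
  have "lab (rg r) (lhs r) \<in> Some ` Fsyms (sig_of P)" if r: "r \<in> grs_of P" for r
  proof -
    obtain i args R where "r = tm_rule (App (Fn i) args) R" "i < length P"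
      using r by (auto simp: grs_of_def term_rules_def)
    then show ?thesis
      using rule.lab_tm_graph[of "App (Fn i) args" "App (Fn i) args" R] by simp
  qed
  moreover have finF: "finite (Fsyms (sig_of P))" by (simp add: Fsyms_def)
  ultimately have finG: "finite (Gfin (grs_of P))" by (intro finite_Gfin)
  define d where "d = Max (sar (sig_of P) ` Fsyms (sig_of P) \<union> (\<lambda>r. gsize (rhsG r)) ` Gfin (grs_of P))"
  have arity: "sar (sig_of P) a \<le> d" if "a \<in> Fsyms (sig_of P)" for a
    unfolding d_def using that finF finG by (intro Max_ge) auto
  have "gsize (rhsG r) \<le> d" if "r \<in> Gfin (grs_of P)" for r
    unfolding d_def using that finF finG by (intro Max_ge) auto
  moreover have "inf_rule_conds (sig_of P) d r" if r: "r \<in> Ginf (grs_of P)" for r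
    using r
  proof (rule Ginf_grs_ofE)
    fix i h t m
    assume i: "i < length P" and h: "scheme (P ! i) = Recursion h" "gterm_ok cs ar t"
      "m = normals (P ! i) + safes (P ! i) - 1"
      and r: "r = tm_rule (App (Fn i) (emb t # map Var [0..<m])) (unfolding_tm h m t)"
    have "m \<le> d" using arity[of "Fn i"] i h(3) by simp
    moreover have "scheme_ok P (P ! i)" using fundef_ok_nth[OF P i] by (simp add: fundef_ok_def)
    ultimately show ?thesis unfolding r using h by (intro inf_rule_conds_Recursion)
  qed
  ultimately show ?thesis using arity by blast
qed

end

section \<open>Programs for general safe recursive functions\<close>

lemma eval_nth_map: "vars t \<subseteq> {..<n} \<Longrightarrow> eval I ((!) (map \<sigma> [0..<n])) t = eval I \<sigma> t"
  by (rule eval_cong) auto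

lemma map_nth_append:
  "map ((!) (xs @ ys)) [0..<length xs] = xs"
  "map ((!) (xs @ ys)) [length xs..<length xs + length ys] = ys"
  by (auto simp: nth_append intro: nth_equalityI)

lemma vargs_take_drop:
  assumes "vargs cs ar (k + l) us"
  shows "vargs cs ar k (take k us)" and "vargs cs ar l (drop k us)"
  using assms by (auto simp: vargs_def dest: in_set_takeD in_set_dropD)

context constructors
begin

definition covered :: "'c program \<Rightarrow> 'c fundef \<Rightarrow> 'c gterm list \<Rightarrow> bool" where
  "covered P E us \<longleftrightarrow> (\<exists>(args, R)\<in>equations E. \<exists>\<sigma>.
     (\<forall>x\<in>\<Union> (vars ` set args). gterm_ok cs ar (\<sigma> x)) \<and> map (eval (interp P) \<sigma>) args = us)"

lemma coveredI:
  assumes "(args, R) \<in> equations E" and "\<Union> (vars ` set args) \<subseteq> {..<length us}"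
    and "\<forall>u\<in>set us. gterm_ok cs ar u" and "map (eval (interp P) ((!) us)) args = ts"
  shows "covered P E ts"
  using assms unfolding covered_def by (fastforce intro!: bexI[of _ "(args, R)"] exI[of _ "(!) us"])

lemma total_if_covered:
  assumes P: "program_ok P" and ok: "\<And>args R. (args, R) \<in> equations E \<Longrightarrow> equation_ok P E args R"
    and cover: "\<And>xs ys. vargs cs ar (normals E) xs \<Longrightarrow> vargs cs ar (safes E) ys \<Longrightarrow> covered P E (xs @ ys)"
  shows "total E"
  unfolding total_def
proof (intro allI impI)
  fix xs ys assume v: "vargs cs ar (normals E) xs \<and> vargs cs ar (safes E) ys"
  then obtain args R \<sigma> where "(args, R) \<in> equations E"
    and \<sigma>: "\<forall>x\<in>\<Union> (vars ` set args). gterm_ok cs ar (\<sigma> x)"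
    and us: "map (eval (interp P) \<sigma>) args = xs @ ys"
    using cover[of xs ys] by (auto simp: covered_def)
  then have eq: "equation_ok P E args R" by (intro ok)
  have "meaning E (take (normals E) (xs @ ys)) (drop (normals E) (xs @ ys)) = eval (interp P) \<sigma> R"
    unfolding us[symmetric] using eq \<sigma> by (simp add: equation_ok_def)
  then have "meaning E xs ys = eval (interp P) \<sigma> R" using v by (simp add: vargs_def)
  moreover have "gterm_ok cs ar (eval (interp P) \<sigma> R)"
    using eq \<sigma> by (intro gterm_ok_eval[OF P]) (auto simp: equation_ok_def)
  ultimately show "gterm_ok cs ar (meaning E xs ys)" by simp
qed

lemma fundef_ok_Explicit:
  assumes P: "program_ok P" and wf: "tm_ok (sig_of P) R" and vars: "vars R \<subseteq> {..<k + l}"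
    and pt: "tm_pt (sig_of P) k (map Var [0..<k + l]) R"
    and f: "\<And>us. vargs cs ar (k + l) us \<Longrightarrow> f (take k us) (drop k us) = eval (interp P) ((!) us) R"
  shows "fundef_ok P (Fundef k l f (Explicit R))" (is "fundef_ok P ?E")
proof -
  have "equation_ok P ?E args R'" if "(args, R') \<in> equations ?E" for args R'
  proof -
    have args: "args = map Var [0..<k + l]" "R' = R" using that by (auto simp: equations_def)
    have "f (take k (map \<sigma> [0..<k + l])) (drop k (map \<sigma> [0..<k + l])) = eval (interp P) \<sigma> R"
      if "\<And>x. x < k + l \<Longrightarrow> gterm_ok cs ar (\<sigma> x)" for \<sigma>
      using f[of "map \<sigma> [0..<k + l]"] that vars by (simp add: vargs_def eval_nth_map)
    then show ?thesis
      using wf vars pt unfolding args by (auto simp: equation_ok_def comp_def)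
  qed
  moreover have "covered P ?E (xs @ ys)"
    if "vargs cs ar (normals ?E) xs" "vargs cs ar (safes ?E) ys" for xs ys
  proof (rule coveredI)
    show "(map Var [0..<k + l], R) \<in> equations ?E" by (simp add: equations_def)
    show "map (eval (interp P) ((!) (xs @ ys))) (map Var [0..<k + l]) = xs @ ys"
      using that map_nth[of "xs @ ys"] by (simp add: vargs_def comp_def)
  qed (use that in \<open>auto simp: vargs_def\<close>)
  ultimately show ?thesis
    using total_if_covered[OF P, of ?E] by (auto simp: fundef_ok_def scheme_ok_def)
qed

lemma fundef_ok_Cases:
  assumes P: "program_ok P" and wf: "\<And>c. c \<in> set cs \<Longrightarrow> tm_ok (sig_of P) (B c)"
    and vars: "\<And>c. c \<in> set cs \<Longrightarrow> vars (B c) \<subseteq> {..<ar c + l}"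
    and pt: "\<And>c. c \<in> set cs \<Longrightarrow>
      tm_pt (sig_of P) 0 (App (Con c) (map Var [0..<ar c]) # map Var [ar c..<ar c + l]) (B c)"
    and f: "\<And>c us. c \<in> set cs \<Longrightarrow> vargs cs ar (ar c + l) us \<Longrightarrow>
      f [] (T c (take (ar c) us) # drop (ar c) us) = eval (interp P) ((!) us) (B c)"
  shows "fundef_ok P (Fundef 0 (Suc l) f (Cases B))" (is "fundef_ok P ?E")
proof -
  have "equation_ok P ?E args R" if eq: "(args, R) \<in> equations ?E" for args R
  proof -
    obtain c where c: "c \<in> set cs" and
      args: "args = App (Con c) (map Var [0..<ar c]) # map Var [ar c..<ar c + l]" "R = B c"
      using eq by (auto simp: equations_def)
    have "f [] (T c (map \<sigma> [0..<ar c]) # map \<sigma> [ar c..<ar c + l]) = eval (interp P) \<sigma> R"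
      if "\<And>x. x < ar c + l \<Longrightarrow> gterm_ok cs ar (\<sigma> x)" for \<sigma>
      using f[OF c, of "map \<sigma> [0..<ar c + l]"] that vars[OF c]
      by (simp add: vargs_def eval_nth_map args(2) take_map drop_map take_upt drop_upt)
    moreover have "(\<Union> (vars ` set args)) = {..<ar c + l}" by (auto simp: args(1))
    ultimately show ?thesis
      using wf[OF c] vars[OF c] pt[OF c] c unfolding equation_ok_def by (auto simp: args comp_def)
  qed
  moreover have "covered P ?E (xs @ ys)"
    if xs: "vargs cs ar (normals ?E) xs" and ys: "vargs cs ar (safes ?E) ys" for xs ys
  proof -
    obtain c ts zs where ys': "ys = T c ts # zs"
      using ys by (cases ys; cases "hd ys") (auto simp: vargs_def)
    then have c: "c \<in> set cs" "length ts = ar c" "length zs = l" using ys by (auto simp: vargs_def)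
    show ?thesis
    proof (rule coveredI)
      let ?args = "App (Con c) (map Var [0..<ar c]) # map Var [ar c..<ar c + l]"
      show "(?args, B c) \<in> equations ?E" using c(1) by (simp add: equations_def)
      show "map (eval (interp P) ((!) (ts @ zs))) ?args = xs @ ys"
        using xs map_nth_append[of ts zs] by (simp add: ys' c(2,3) vargs_def comp_def)
    qed (use ys ys' c in \<open>auto simp: vargs_def\<close>)
  qed
  ultimately show ?thesis
    using total_if_covered[OF P, of ?E] by (auto simp: fundef_ok_def scheme_ok_def)
qed

lemma tm_ok_emb: "gterm_ok cs ar t \<Longrightarrow> tm_ok (sig_of P) (emb t)"
  by (induction t) auto

lemma set_tm_emb: "gterm_ok cs ar t \<Longrightarrow> set_tm (emb t) \<subseteq> Con ` set cs"
  by (induction t) auto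

lemma tm_ok_unfolding_tm:
  assumes h: "\<And>c. c \<in> set cs \<Longrightarrow> h c < length P \<and> normals (P ! h c) + safes (P ! h c) = ar c + m + ar c"
  shows "gterm_ok cs ar t \<Longrightarrow> tm_ok (sig_of P) (unfolding_tm h m t)"
proof (induction t)
  case (T c ts)
  then show ?case using h[of c] by (auto simp: tm_ok_emb)
qed

lemma tm_pt_unfolding_tm:
  assumes h: "\<And>c. c \<in> set cs \<Longrightarrow> normals (P ! h c) = ar c + k"
  shows "gterm_ok cs ar s \<Longrightarrow> emb s \<in> subterms (emb t) \<Longrightarrow>
    tm_pt (sig_of P) (Suc k) (emb t # map Var [0..<k + l]) (unfolding_tm h (k + l) s)"
proof (induction s)
  case (T c ts)
  let ?args = "emb t # map Var [0..<k + l]"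
  let ?normal = "map emb ts @ map Var [0..<k]"
  let ?safe = "map Var [k..<k + l] @ map (unfolding_tm h (k + l)) ts"
  have split: "map emb ts @ map Var [0..<k + l] @ map (unfolding_tm h (k + l)) ts = ?normal @ ?safe"
    by (simp add: upt_add_eq_append[of 0 k l, simplified])
  have len: "snn (sig_of P) (Fn (h c)) = length ?normal" using T.prems(1) h by simp
  have sub: "emb u \<in> subterms (emb t)" if "u \<in> set ts" for u
  proof -
    have "emb u \<in> subterms (emb (T c ts))"
      using that arg_in_subterms[of "emb u" "map emb ts" "Con c"] by simp
    then show ?thesis using subterms_subset[OF T.prems(2)] by blast
  qed
  show ?case
    unfolding unfolding_tm.simps split
  proof (rule tm_pt.app)
    show "\<forall>u\<in>set (take (snn (sig_of P) (Fn (h c))) (?normal @ ?safe)).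
        \<exists>s\<in>set (take (Suc k) ?args). u \<in> subterms s"
      unfolding len using sub by (auto simp: take_map take_upt)
    show "\<forall>u\<in>set (drop (snn (sig_of P) (Fn (h c))) (?normal @ ?safe)). tm_pt (sig_of P) (Suc k) ?args u"
      unfolding len using T sub by (auto intro: tm_pt.arg)
  qed
qed

lemma eval_unfolding_tm:
  assumes h: "\<And>c. c \<in> set cs \<Longrightarrow> normals (P ! h c) = ar c + k"
    and f: "\<And>c ts. c \<in> set cs \<Longrightarrow> vargs cs ar (ar c) ts \<Longrightarrow> f (T c ts # take k us) (drop k us)
      = meaning (P ! h c) (ts @ take k us) (drop k us @ map (\<lambda>t. f (t # take k us) (drop k us)) ts)"
    and us: "length us = k + l"
  shows "gterm_ok cs ar t \<Longrightarrow>
    eval (interp P) ((!) us) (unfolding_tm h (k + l) t) = f (t # take k us) (drop k us)"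
proof (induction t)
  case (T c ts)
  let ?eval = "eval (interp P) ((!) us)"
  have c: "c \<in> set cs" "length ts = ar c" "vargs cs ar (ar c) ts"
    using T.prems by (auto simp: vargs_def)
  have embs: "map ?eval (map emb ts) = ts" by (simp add: eval_emb map_idI)
  have vars: "map ?eval (map Var [0..<k + l]) = take k us @ drop k us"
    using map_nth[of us] us by (simp add: comp_def)
  have unfolded: "map ?eval (map (unfolding_tm h (k + l)) ts)
      = map (\<lambda>t. f (t # take k us) (drop k us)) ts"
    using T by auto
  have "?eval (unfolding_tm h (k + l) (T c ts)) = interp P (Fn (h c)) (map ?eval (map emb ts)
      @ map ?eval (map Var [0..<k + l]) @ map ?eval (map (unfolding_tm h (k + l)) ts))"
    by (simp only: unfolding_tm.simps eval.simps map_append)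
  also have "\<dots> = meaning (P ! h c) (ts @ take k us)
      (drop k us @ map (\<lambda>t. f (t # take k us) (drop k us)) ts)"
    unfolding embs vars unfolded using h[OF c(1)] c(2) us by simp
  finally show ?case using f[OF c(1,3)] by simp
qed

lemma equation_ok_unfolding_tm:
  assumes h: "\<And>c. c \<in> set cs \<Longrightarrow> h c < length P \<and> normals (P ! h c) = ar c + k \<and> safes (P ! h c) = l + ar c"
    and f: "\<And>c ts us. c \<in> set cs \<Longrightarrow> vargs cs ar (ar c) ts \<Longrightarrow> vargs cs ar (k + l) us \<Longrightarrow>
      f (T c ts # take k us) (drop k us)
      = meaning (P ! h c) (ts @ take k us) (drop k us @ map (\<lambda>t. f (t # take k us) (drop k us)) ts)"
    and t: "gterm_ok cs ar t"
  shows "equation_ok P (Fundef (Suc k) l f s) (emb t # map Var [0..<k + l]) (unfolding_tm h (k + l) t)"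
    (is "equation_ok P _ ?args ?R")
proof -
  have vars: "\<Union> (vars ` set ?args) = {..<k + l}" by auto
  have "f (t # map \<sigma> [0..<k]) (map \<sigma> [k..<k + l]) = eval (interp P) \<sigma> ?R"
    if "\<And>x. x < k + l \<Longrightarrow> gterm_ok cs ar (\<sigma> x)" for \<sigma>
    using eval_unfolding_tm[of P h k f "map \<sigma> [0..<k + l]" l t] h f[of _ _ "map \<sigma> [0..<k + l]"] that t
    by (simp add: vargs_def eval_nth_map[OF vars_unfolding_tm] take_map drop_map take_upt drop_upt)
  then show ?thesis
    using t h vars_unfolding_tm[of h "k + l" t] tm_ok_unfolding_tm[of h P "k + l" t] tm_ok_emb set_tm_emb
      tm_pt_unfolding_tm[of P h k t t l]
    unfolding equation_ok_def vars
    by (auto simp: eval_emb comp_def take_map drop_map take_upt drop_upt)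
qed

lemma fundef_ok_Recursion:
  assumes P: "program_ok P"
    and h: "\<And>c. c \<in> set cs \<Longrightarrow> h c < length P \<and> normals (P ! h c) = ar c + k \<and> safes (P ! h c) = l + ar c"
    and f: "\<And>c ts us. c \<in> set cs \<Longrightarrow> vargs cs ar (ar c) ts \<Longrightarrow> vargs cs ar (k + l) us \<Longrightarrow>
      f (T c ts # take k us) (drop k us)
      = meaning (P ! h c) (ts @ take k us) (drop k us @ map (\<lambda>t. f (t # take k us) (drop k us)) ts)"
  shows "fundef_ok P (Fundef (Suc k) l f (Recursion h))" (is "fundef_ok P ?E")
proof -
  let ?m = "k + l"
  have "equation_ok P ?E args R" if "(args, R) \<in> equations ?E" for args R
    using that equation_ok_unfolding_tm[OF h f] by (auto simp: equations_def Let_def)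
  moreover have "covered P ?E (xs @ zs)"
    if xs: "vargs cs ar (normals ?E) xs" and zs: "vargs cs ar (safes ?E) zs" for xs zs
  proof -
    obtain t ys where xs': "xs = t # ys" using xs by (cases xs) (auto simp: vargs_def)
    then have t: "gterm_ok cs ar t" "length (ys @ zs) = ?m" using xs zs by (auto simp: vargs_def)
    show ?thesis
    proof (rule coveredI)
      let ?args = "emb t # map Var [0..<?m]"
      show "(?args, unfolding_tm h ?m t) \<in> equations ?E"
        using t(1) by (simp add: equations_def Let_def)
      show "map (eval (interp P) ((!) (ys @ zs))) ?args = xs @ zs"
        using map_nth[of "ys @ zs"] t(2) by (simp add: xs' eval_emb comp_def)
    qed (use xs zs xs' t(2) in \<open>auto simp: vargs_def\<close>)
  qed
  moreover have "scheme_ok P ?E" using h by (simp add: scheme_ok_def)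
  ultimately show ?thesis
    using total_if_covered[OF P, of ?E] by (auto simp: fundef_ok_def)
qed

definition realizes ::
  "'c program \<Rightarrow> nat \<Rightarrow> nat \<Rightarrow> ('c gterm list \<Rightarrow> 'c gterm list \<Rightarrow> 'c gterm) \<Rightarrow> nat \<Rightarrow> bool" where
  "realizes P k l f i \<longleftrightarrow> i < length P \<and> normals (P ! i) = k \<and> safes (P ! i) = l \<and> meaning (P ! i) = f"

definition realizable :: "nat \<Rightarrow> nat \<Rightarrow> ('c gterm list \<Rightarrow> 'c gterm list \<Rightarrow> 'c gterm) \<Rightarrow> bool" where
  "realizable k l f \<longleftrightarrow> (\<forall>P. program_ok P \<longrightarrow> (\<exists>Q i. program_ok (P @ Q) \<and> realizes (P @ Q) k l f i))"

lemma realizes_append: "realizes P k l f i \<Longrightarrow> realizes (P @ Q) k l f i"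
  by (simp add: realizes_def nth_append)

lemma realizableI:
  assumes "\<And>P. program_ok P \<Longrightarrow> \<exists>Q s. program_ok (P @ Q) \<and> fundef_ok (P @ Q) (Fundef k l f s)"
  shows "realizable k l f"
  unfolding realizable_def
proof (intro allI impI)
  fix P assume "program_ok P"
  then obtain Q s where "program_ok (P @ Q)" "fundef_ok (P @ Q) (Fundef k l f s)"
    using assms by blast
  then have "program_ok (P @ Q @ [Fundef k l f s])" using program_ok_snoc by fastforce
  moreover have "realizes (P @ Q @ [Fundef k l f s]) k l f (length (P @ Q))"
    by (simp add: realizes_def nth_append)
  ultimately show "\<exists>Q i. program_ok (P @ Q) \<and> realizes (P @ Q) k l f i" by blast
qed

lemma realizable_if_fundef_ok:
  assumes "\<And>P. program_ok P \<Longrightarrow> fundef_ok P (Fundef k l f s)"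
  shows "realizable k l f"
  using assms by (intro realizableI) (metis append_Nil2)

lemma realizes_all:
  assumes "finite F" and "\<forall>(k, l, f)\<in>F. realizable k l f" and "program_ok P"
  shows "\<exists>Q. program_ok (P @ Q) \<and> (\<forall>(k, l, f)\<in>F. \<exists>i. realizes (P @ Q) k l f i)"
  using assms(1,2)
proof (induction F rule: finite_induct)
  case empty
  then show ?case using assms(3) by (auto intro: exI[of _ "[]"])
next
  case (insert x F)
  then obtain Q where Q: "program_ok (P @ Q)" "\<forall>(k, l, f)\<in>F. \<exists>i. realizes (P @ Q) k l f i" by auto
  obtain k l f where x: "x = (k, l, f)" by (cases x)
  then have "realizable k l f" using insert.prems by auto
  then obtain Q' i where "program_ok ((P @ Q) @ Q')" "realizes ((P @ Q) @ Q') k l f i"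
    using Q(1) unfolding realizable_def by blast
  moreover have "\<forall>(k, l, f)\<in>F. \<exists>i. realizes ((P @ Q) @ Q') k l f i"
    using Q(2) realizes_append by fast
  ultimately show ?case
    unfolding x by (intro exI[of _ "Q @ Q'"]) auto
qed

lemma realizable_const:
  assumes "c \<in> set cs" and "ar c = 0"
    and f: "\<And>xs ys. vargs cs ar k xs \<Longrightarrow> vargs cs ar l ys \<Longrightarrow> f xs ys = T c []"
  shows "realizable k l f"
proof (rule realizable_if_fundef_ok)
  fix P assume P: "program_ok P"
  show "fundef_ok P (Fundef k l f (Explicit (App (Con c) [])))"
    using assms(1,2) f[OF vargs_take_drop]
    by (intro fundef_ok_Explicit[OF P]) (auto intro: tm_pt.app)
qed

lemma realizable_constructor:
  assumes c: "c \<in> set cs" and f: "\<And>ys. vargs cs ar (ar c) ys \<Longrightarrow> f [] ys = T c ys"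
  shows "realizable 0 (ar c) f"
proof (rule realizable_if_fundef_ok)
  fix P assume P: "program_ok P"
  show "fundef_ok P (Fundef 0 (ar c) f (Explicit (App (Con c) (map Var [0..<ar c]))))"
  proof (rule fundef_ok_Explicit[OF P])
    show "tm_pt (sig_of P) 0 (map Var [0..<0 + ar c]) (App (Con c) (map Var [0..<ar c]))"
      by (rule tm_pt.app) (auto intro: tm_pt.arg)
    show "f (take 0 us) (drop 0 us) = eval (interp P) ((!) us) (App (Con c) (map Var [0..<ar c]))"
      if "vargs cs ar (0 + ar c) us" for us
      using that f[of us] map_nth[of us] by (simp add: vargs_def comp_def)
  qed (use c in auto)
qed

lemma realizable_proj:
  assumes j: "j < k + l"
    and f: "\<And>xs ys. vargs cs ar k xs \<Longrightarrow> vargs cs ar l ys \<Longrightarrow> f xs ys = (xs @ ys) ! j"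
  shows "realizable k l f"
proof (rule realizable_if_fundef_ok)
  fix P assume P: "program_ok P"
  show "fundef_ok P (Fundef k l f (Explicit (Var j)))"
    using j f[OF vargs_take_drop] by (intro fundef_ok_Explicit[OF P]) (auto intro: tm_pt.arg)
qed

lemma realizable_pred:
  assumes j: "j \<le> ar c"
    and pred: "\<And>ts. gterm_ok cs ar (T c ts) \<Longrightarrow> f [] [T c ts] = (if j = 0 then T c ts else ts ! (j - 1))"
    and other: "\<And>b ts. gterm_ok cs ar (T b ts) \<Longrightarrow> b \<noteq> c \<Longrightarrow> f [] [T b ts] = T b ts"
  shows "realizable 0 1 f"
  unfolding One_nat_def
proof -
  define B where "B b = (if b = c \<and> j \<noteq> 0 then Var (j - 1) else App (Con b) (map Var [0..<ar b]))" for b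
  have "fundef_ok P (Fundef 0 (Suc 0) f (Cases B))" if P: "program_ok P" for P
  proof (rule fundef_ok_Cases[OF P])
    fix b assume b: "b \<in> set cs"
    show "tm_ok (sig_of P) (B b)" using b by (simp add: B_def)
    show "vars (B b) \<subseteq> {..<ar b + 0}" using j by (auto simp: B_def)
    have "j - 1 \<in> vars (App (Con c) (map Var [0..<ar c]))" if "j \<noteq> 0"
      using that j by auto
    then show "tm_pt (sig_of P) 0 (App (Con b) (map Var [0..<ar b]) # map Var [ar b..<ar b + 0]) (B b)"
      by (auto simp: B_def simp del: vars.simps intro: tm_pt.arg tm_pt.var)
    fix us assume us: "vargs cs ar (ar b + 0) us"
    then have "gterm_ok cs ar (T b us)" using b by (auto simp: vargs_def)
    then have "f [] [T b us] = (if b = c \<and> j \<noteq> 0 then us ! (j - 1) else T b us)"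
      using pred[of us] other[of b us] by (cases "b = c") (simp_all del: gterm_ok.simps)
    then show "f [] (T b (take (ar b) us) # drop (ar b) us) = eval (interp P) ((!) us) (B b)"
      using us map_nth[of us] by (simp add: B_def vargs_def comp_def)
  qed
  then show "realizable 0 (Suc 0) f" by (rule realizable_if_fundef_ok)
qed

lemma index_in_enumeration:
  obtains idx where "\<forall>c\<in>set cs. idx c < length cs \<and> cs ! idx c = c"
proof -
  have "\<forall>c\<in>set cs. \<exists>j. j < length cs \<and> cs ! j = c" by (auto simp: in_set_conv_nth)
  then show ?thesis using that by (rule bchoice[THEN exE])
qed

lemma realizable_cond:
  assumes f: "\<And>j ts zs. j < length cs \<Longrightarrow> gterm_ok cs ar (T (cs ! j) ts) \<Longrightarrow> vargs cs ar (length cs) zs \<Longrightarrow>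
    f [] (T (cs ! j) ts # zs) = zs ! j"
  shows "realizable 0 (Suc (length cs)) f"
proof -
  obtain idx where idx: "\<forall>c\<in>set cs. idx c < length cs \<and> cs ! idx c = c"
    by (rule index_in_enumeration)
  have "fundef_ok P (Fundef 0 (Suc (length cs)) f (Cases (\<lambda>c. Var (ar c + idx c))))"
    if P: "program_ok P" for P
  proof (rule fundef_ok_Cases[OF P])
    fix c assume c: "c \<in> set cs"
    show "tm_pt (sig_of P) 0 (App (Con c) (map Var [0..<ar c]) # map Var [ar c..<ar c + length cs])
        (Var (ar c + idx c))"
      using idx c by (auto intro!: tm_pt.arg)
    fix us assume us: "vargs cs ar (ar c + length cs) us"
    then have "gterm_ok cs ar (T c (take (ar c) us))"
      using c vargs_take_drop(1)[OF us] by (simp add: vargs_def)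
    then have "f [] (T c (take (ar c) us) # drop (ar c) us) = drop (ar c) us ! idx c"
      using f[of "idx c"] idx c vargs_take_drop(2)[OF us] by metis
    then show "f [] (T c (take (ar c) us) # drop (ar c) us)
        = eval (interp P) ((!) us) (Var (ar c + idx c))"
      using us by (simp add: vargs_def)
  qed (use idx in auto)
  then show ?thesis by (rule realizable_if_fundef_ok)
qed

lemma fundef_ok_comp:
  assumes P: "program_ok P" and h: "realizes P (length js) (length gs) h ih"
    and g: "\<And>g. g \<in> set gs \<Longrightarrow> realizes P k l g (ig g)" and js: "\<And>j. j \<in> set js \<Longrightarrow> j < k"
    and f: "\<And>xs ys. vargs cs ar k xs \<Longrightarrow> vargs cs ar l ys \<Longrightarrow>
      f xs ys = h (map (\<lambda>j. xs ! j) js) (map (\<lambda>g. g xs ys) gs)"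
  shows "fundef_ok P (Fundef k l f (Explicit
    (App (Fn ih) (map Var js @ map (\<lambda>g. App (Fn (ig g)) (map Var [0..<k + l])) gs))))"
proof (rule fundef_ok_Explicit[OF P])
  let ?A = "map Var [0..<k + l] :: 'c sym tm list"
  let ?R = "App (Fn ih) (map Var js @ map (\<lambda>g. App (Fn (ig g)) ?A) gs)"
  note realized = h[unfolded realizes_def] g[unfolded realizes_def]
  show "tm_ok (sig_of P) ?R" using realized by auto
  show "vars ?R \<subseteq> {..<k + l}" using js by (auto intro: trans_less_add1)
  have takeA: "take k ?A = map Var [0..<k]" by (simp add: take_map take_upt)
  have "tm_pt (sig_of P) k ?A (App (Fn (ig g)) ?A)" if "g \<in> set gs" for g
    using realized(2)[OF that]
    by (intro tm_pt.app) (auto simp: takeA dest!: in_set_dropD intro: tm_pt.arg)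
  then show "tm_pt (sig_of P) k ?A ?R"
    using realized(1) js by (intro tm_pt.app) (auto simp: takeA)
  fix us assume us: "vargs cs ar (k + l) us"
  let ?eval = "eval (interp P) ((!) us)"
  have "map ?eval ?A = us" using us map_nth[of us] by (simp add: vargs_def comp_def)
  then have "?eval (App (Fn (ig g)) ?A) = g (take k us) (drop k us)" if "g \<in> set gs" for g
    using realized(2)[OF that] by (simp del: map_map)
  then have "map ?eval (map (\<lambda>g. App (Fn (ig g)) ?A) gs) = map (\<lambda>g. g (take k us) (drop k us)) gs"
    by (simp del: eval.simps)
  moreover have "map ?eval (map Var js) = map (\<lambda>j. take k us ! j) js" using js by simp
  ultimately have "?eval ?R = h (map (\<lambda>j. take k us ! j) js) (map (\<lambda>g. g (take k us) (drop k us)) gs)"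
    using realized(1) by (simp del: map_map)
  then show "f (take k us) (drop k us) = ?eval ?R"
    using f[OF vargs_take_drop[OF us]] by simp
qed

lemma realizable_comp:
  assumes "realizable (length js) (length gs) h" and "\<And>g. g \<in> set gs \<Longrightarrow> realizable k l g"
    and js: "\<And>j. j \<in> set js \<Longrightarrow> j < k"
    and f: "\<And>xs ys. vargs cs ar k xs \<Longrightarrow> vargs cs ar l ys \<Longrightarrow>
      f xs ys = h (map (\<lambda>j. xs ! j) js) (map (\<lambda>g. g xs ys) gs)"
  shows "realizable k l f"
proof (rule realizableI)
  fix P assume P: "program_ok P"
  let ?F = "insert (length js, length gs, h) ((\<lambda>g. (k, l, g)) ` set gs)"
  obtain Q where Q: "program_ok (P @ Q)" and real: "\<forall>(k, l, f)\<in>?F. \<exists>i. realizes (P @ Q) k l f i"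
    using realizes_all[of ?F P] assms(1,2) P by auto
  from real obtain ih where ih: "realizes (P @ Q) (length js) (length gs) h ih" by blast
  from real have "\<forall>g\<in>set gs. \<exists>i. realizes (P @ Q) k l g i" by blast
  then obtain ig where "\<forall>g\<in>set gs. realizes (P @ Q) k l g (ig g)" by (rule bchoice[THEN exE])
  then show "\<exists>Q s. program_ok (P @ Q) \<and> fundef_ok (P @ Q) (Fundef k l f s)"
    using fundef_ok_comp[OF Q ih _ js f] Q by blast
qed

lemma realizable_rec:
  assumes "\<And>c. c \<in> set cs \<Longrightarrow> realizable (ar c + k) (l + ar c) (h c)"
    and f: "\<And>c xs ys zs. c \<in> set cs \<Longrightarrow> vargs cs ar (ar c) xs \<Longrightarrow> vargs cs ar k ys \<Longrightarrow> vargs cs ar l zs \<Longrightarrow>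
      f (T c xs # ys) zs = h c (xs @ ys) (zs @ map (\<lambda>x. f (x # ys) zs) xs)"
  shows "realizable (Suc k) l f"
proof (rule realizableI)
  fix P assume P: "program_ok P"
  let ?F = "(\<lambda>c. (ar c + k, l + ar c, h c)) ` set cs"
  obtain Q where Q: "program_ok (P @ Q)" and "\<forall>(k, l, f)\<in>?F. \<exists>i. realizes (P @ Q) k l f i"
    using realizes_all[of ?F P] assms(1) P by auto
  then have "\<forall>c\<in>set cs. \<exists>i. realizes (P @ Q) (ar c + k) (l + ar c) (h c) i" by auto
  then obtain ih where ih: "\<forall>c\<in>set cs. realizes (P @ Q) (ar c + k) (l + ar c) (h c) (ih c)"
    by (rule bchoice[THEN exE])
  have "fundef_ok (P @ Q) (Fundef (Suc k) l f (Recursion ih))"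
    using ih f[OF _ _ vargs_take_drop]
    by (intro fundef_ok_Recursion[OF Q]) (simp_all add: realizes_def)
  then show "\<exists>Q s. program_ok (P @ Q) \<and> fundef_ok (P @ Q) (Fundef (Suc k) l f s)"
    using Q by blast
qed

lemma realizable_if_gsr: "gsr cs ar k l f \<Longrightarrow> realizable k l f"
proof (induction rule: gsr.induct)
  case (const j k l f)
  then show ?case by (intro realizable_const[of "cs ! j"]) auto
next
  case (cons j f)
  then show ?case by (intro realizable_constructor) auto
next
  case (proj j k l f)
  then show ?case by (intro realizable_proj) auto
next
  case (pred i j f)
  then show ?case by (intro realizable_pred[of j "cs ! i"]) auto
next
  case (cond f)
  then show ?case by (intro realizable_cond) auto
next
  case (comp js gs h k l f)
  show ?case
    by (rule realizable_comp[of js gs h]) (use comp in blast)+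
next
  case (recur hs k l f)
  obtain idx where idx: "\<forall>c\<in>set cs. idx c < length cs \<and> cs ! idx c = c"
    by (rule index_in_enumeration)
  show ?case
  proof (rule realizable_rec)
    fix c assume c: "c \<in> set cs"
    show "realizable (ar c + k) (l + ar c) (hs ! idx c)"
      using recur.IH idx c by metis
    show "f (T c xs # ys) zs = (hs ! idx c) (xs @ ys) (zs @ map (\<lambda>x. f (x # ys) zs) xs)"
      if "vargs cs ar (ar c) xs" "vargs cs ar k ys" "vargs cs ar l zs" for xs ys zs
      using that recur.hyps idx c by metis
  qed
qed

end

theorem mainTheorem9:
  fixes cs :: "'c list" and ar :: "'c \<Rightarrow> nat" and k l :: nat
    and f :: "'c gterm list \<Rightarrow> 'c gterm list \<Rightarrow> 'c gterm"
  assumes "distinct cs"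
    and "\<exists>c\<in>set cs. ar c = 0"
    and "gsr cs ar k l f"
  shows "\<exists>S Gs d. cons S = cs \<and> car S = ar \<and> sig_ok S
     \<and> constructor_grs S Gs \<and> computes S Gs k l f \<and> pt_sep S Gs
     \<and> (\<forall>g\<in>Fsyms S. sar S g \<le> d)
     \<and> (\<forall>R\<in>Gfin Gs. gsize (rhsG R) \<le> d)
     \<and> (\<forall>R\<in>Ginf Gs. inf_rule_conds S d R)"
proof -
  interpret constructors cs ar .
  have "program_ok []" by (simp add: program_ok_def)
  then obtain P i where P: "program_ok P" and i: "realizes P k l f i"
    using realizable_if_gsr[OF assms(3)] unfolding realizable_def by (metis append_Nil)
  have "sig_ok (sig_of P)" by (simp add: sig_ok_def)
  moreover have "computes (sig_of P) (grs_of P) k l f"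
    using grs_of_computes[OF P, of i] i by (simp add: realizes_def)
  moreover obtain d where "\<forall>g\<in>Fsyms (sig_of P). sar (sig_of P) g \<le> d"
    "\<forall>R\<in>Gfin (grs_of P). gsize (rhsG R) \<le> d" "\<forall>R\<in>Ginf (grs_of P). inf_rule_conds (sig_of P) d R"
    using grs_of_bounds[OF P] by blast
  ultimately show ?thesis
    using constructor_grs_grs_of[OF P] pt_sep_grs_of[OF P] sig_of_simps(1,2) by blast
qed

end
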